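(* Let $R$ be a commutative Noetherian ring and let $M$ be a finitely generated $R$-module. Let $\mathfrak a,\mathfrak b$ be two ideals of $R$ such that $\mathfrak b\subseteq\mathfrak a$, and let $n$ be a non-negative integer. Then $$h_{\mathfrak a}^{\mathfrak b}(M)^{n}\ge\operatorname{depth}(\mathfrak b,M)\iff h_{\mathfrak a}^{n}(M)\ge\operatorname{depth}(\mathfrak b,M).$$
   Context: $R$ has non-zero identity; $H^i_{\mathfrak a}(M)$ denotes local cohomology; $\inf\emptyset=\infty$. For a non-negative integer $n$, an $R$-module $L$ is in dimension $<n$ if there is a finitely generated submodule $N$ of $L$ with $\dim\operatorname{Supp}(L/N)<n$ (the empty set has negative dimension). Define $$h_{\mathfrak a}^{n}(M):=\inf\{i\in\mathbb{N}_0 : H^i_{\mathfrak a}(M)\text{ is not in dimension }<n\},$$ $$h_{\mathfrak a}^{\mathfrak b}(M)^{n}:=\inf\{i\in\mathbb{N}_0 : \mathfrak b^tH^i_{\mathfrak a}(M)\text{ is not in dimension }<n\text{ for all }t\in\mathbb{N}\}.$$ $\operatorname{depth}(\mathfrak b,M)$ is the usual $\mathfrak b$-depth (grade) of $M$, i.e. $\inf\{i : \operatorname{Ext}^i_R(R/\mathfrak b,M)\neq 0\}$ (the length of a maximal $M$-regular sequence in $\mathfrak b$ when $\mathfrak bM\ne M$, and $\infty$ otherwise). *)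

theory Defs
  imports
    "HOL-Algebra.Module"
    "HOL-Algebra.Ideal_Product"
    "HOL-Algebra.Ring_Divisibility"
    "HOL-Library.Extended_Nat"
    "HOL-Library.Extended_Real"
begin

section \<open>Modules\<close>

text \<open>
  All constructions below return records of type \<^typ>\<open>('r, 'm) module\<close>. The fields \<^const>\<open>monoid.mult\<close> and
  \<^const>\<open>one\<close> of such a record carry no information for modules and are left undefined.
\<close>

definition submod_gen ::
    "('r, 'q) ring_scheme \<Rightarrow> ('r, 'm, 'x) module_scheme \<Rightarrow> 'm set \<Rightarrow> 'm set" where
  "submod_gen R M A = \<Inter> {H. submodule H R M \<and> A \<subseteq> H}"

definition finitely_generated ::
    "('r, 'q) ring_scheme \<Rightarrow> ('r, 'm, 'x) module_scheme \<Rightarrow> bool" where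
  "finitely_generated R M \<longleftrightarrow>
     (\<exists>A. finite A \<and> A \<subseteq> carrier M \<and> submod_gen R M A = carrier M)"

definition ideal_smult ::
    "('r, 'q) ring_scheme \<Rightarrow> 'r set \<Rightarrow> ('r, 'm, 'x) module_scheme \<Rightarrow> 'm set" where
  "ideal_smult R I M = submod_gen R M {r \<odot>\<^bsub>M\<^esub> x | r x. r \<in> I \<and> x \<in> carrier M}"

definition ring_mod :: "('r, 'q) ring_scheme \<Rightarrow> ('r, 'r) module" where
  "ring_mod R = \<lparr>carrier = carrier R, monoid.mult = undefined, one = undefined,
     zero = \<zero>\<^bsub>R\<^esub>, add = (\<oplus>\<^bsub>R\<^esub>), smult = (\<otimes>\<^bsub>R\<^esub>)\<rparr>"

text \<open>The quotient \<open>M/N\<close>; note that \<open>N + r \<cdot> (N + x) = N + r x\<close>.\<close>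

definition quot_mod ::
    "('r, 'm, 'x) module_scheme \<Rightarrow> 'm set \<Rightarrow> ('r, 'm set) module" where
  "quot_mod M N = \<lparr>carrier = a_rcosets\<^bsub>M\<^esub> N, monoid.mult = undefined, one = undefined,
     zero = N, add = set_add M, smult = (\<lambda>r X. N <+>\<^bsub>M\<^esub> (\<lambda>x. r \<odot>\<^bsub>M\<^esub> x) ` X)\<rparr>"

text \<open>Linear maps are taken extensional, so that equality of linear maps is equality of functions.\<close>

definition lin_maps ::
    "('r, 'q) ring_scheme \<Rightarrow> ('r, 'm, 'x) module_scheme \<Rightarrow> ('r, 'n, 'y) module_scheme
      \<Rightarrow> ('m \<Rightarrow> 'n) set" where
  "lin_maps R M N = {f \<in> carrier M \<rightarrow>\<^sub>E carrier N.
     (\<forall>x\<in>carrier M. \<forall>y\<in>carrier M. f (x \<oplus>\<^bsub>M\<^esub> y) = f x \<oplus>\<^bsub>N\<^esub> f y) \<and>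
     (\<forall>r\<in>carrier R. \<forall>x\<in>carrier M. f (r \<odot>\<^bsub>M\<^esub> x) = r \<odot>\<^bsub>N\<^esub> f x)}"

definition hom_mod ::
    "('r, 'q) ring_scheme \<Rightarrow> ('r, 'm, 'x) module_scheme \<Rightarrow> ('r, 'n, 'y) module_scheme
      \<Rightarrow> ('r, 'm \<Rightarrow> 'n) module" where
  "hom_mod R M N = \<lparr>carrier = lin_maps R M N, monoid.mult = undefined, one = undefined,
     zero = (\<lambda>x\<in>carrier M. \<zero>\<^bsub>N\<^esub>),
     add = (\<lambda>f g. \<lambda>x\<in>carrier M. f x \<oplus>\<^bsub>N\<^esub> g x),
     smult = (\<lambda>r f. \<lambda>x\<in>carrier M. r \<odot>\<^bsub>N\<^esub> f x)\<rparr>"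

text \<open>The free module \<open>R\<^sup>k\<close>, realised by functions that are undefined outside \<open>{..<k}\<close>.\<close>

definition free_mod :: "('r, 'q) ring_scheme \<Rightarrow> nat \<Rightarrow> ('r, nat \<Rightarrow> 'r) module" where
  "free_mod R k = \<lparr>carrier = {..<k} \<rightarrow>\<^sub>E carrier R, monoid.mult = undefined, one = undefined,
     zero = (\<lambda>i\<in>{..<k}. \<zero>\<^bsub>R\<^esub>),
     add = (\<lambda>x y. \<lambda>i\<in>{..<k}. x i \<oplus>\<^bsub>R\<^esub> y i),
     smult = (\<lambda>r x. \<lambda>i\<in>{..<k}. r \<otimes>\<^bsub>R\<^esub> x i)\<rparr>"

text \<open>
  The direct limit of a system \<open>\<theta> s t : G s \<rightarrow> G t\<close> (for \<open>s \<le> t\<close>) of modules indexed by the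
  natural numbers: \<open>(s, x)\<close> and \<open>(t, y)\<close> are identified if they become equal in some later \<open>G u\<close>.
\<close>

definition dirlim_class ::
    "(nat \<Rightarrow> ('r, 'm, 'x) module_scheme) \<Rightarrow> (nat \<Rightarrow> nat \<Rightarrow> 'm \<Rightarrow> 'm) \<Rightarrow> nat \<times> 'm
      \<Rightarrow> (nat \<times> 'm) set" where
  "dirlim_class G \<theta> = (\<lambda>(s, x).
     {(t, y). y \<in> carrier (G t) \<and> (\<exists>u. s \<le> u \<and> t \<le> u \<and> \<theta> s u x = \<theta> t u y)})"

definition dirlim ::
    "(nat \<Rightarrow> ('r, 'm, 'x) module_scheme) \<Rightarrow> (nat \<Rightarrow> nat \<Rightarrow> 'm \<Rightarrow> 'm)
      \<Rightarrow> ('r, (nat \<times> 'm) set) module" where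
  "dirlim G \<theta> = \<lparr>
     carrier = dirlim_class G \<theta> ` (SIGMA t:UNIV. carrier (G t)),
     monoid.mult = undefined, one = undefined,
     zero = dirlim_class G \<theta> (0, \<zero>\<^bsub>G 0\<^esub>),
     add = (\<lambda>X Y. \<Union>(s, x)\<in>X. \<Union>(t, y)\<in>Y.
       dirlim_class G \<theta> (max s t, \<theta> s (max s t) x \<oplus>\<^bsub>G (max s t)\<^esub> \<theta> t (max s t) y)),
     smult = (\<lambda>r X. \<Union>(s, x)\<in>X. dirlim_class G \<theta> (s, r \<odot>\<^bsub>G s\<^esub> x))\<rparr>"


section \<open>Ext and local cohomology\<close>

text \<open>
  A resolution \<open>\<dots> \<rightarrow> R\<^bsup>rk 2\<^esup> \<rightarrow> R\<^bsup>rk 1\<^esup> \<rightarrow> R\<^bsup>rk 0\<^esup> \<rightarrow> N \<rightarrow> 0\<close> by free modules of finite rank, where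
  \<open>bd i : R\<^bsup>rk (i+1)\<^esup> \<rightarrow> R\<^bsup>rk i\<^esup>\<close> and \<open>aug : R\<^bsup>rk 0\<^esup> \<rightarrow> N\<close>.
\<close>

record ('r, 'n) free_complex =
  rk :: "nat \<Rightarrow> nat"
  bd :: "nat \<Rightarrow> (nat \<Rightarrow> 'r) \<Rightarrow> (nat \<Rightarrow> 'r)"
  aug :: "(nat \<Rightarrow> 'r) \<Rightarrow> 'n"

definition free_resolution ::
    "('r, 'q) ring_scheme \<Rightarrow> ('r, 'n, 'y) module_scheme \<Rightarrow> ('r, 'n) free_complex \<Rightarrow> bool" where
  "free_resolution R N F \<longleftrightarrow>
     aug F \<in> lin_maps R (free_mod R (rk F 0)) N \<and>
     (\<forall>i. bd F i \<in> lin_maps R (free_mod R (rk F (Suc i))) (free_mod R (rk F i))) \<and>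
     aug F ` carrier (free_mod R (rk F 0)) = carrier N \<and>
     bd F 0 ` carrier (free_mod R (rk F 1)) =
       {x \<in> carrier (free_mod R (rk F 0)). aug F x = \<zero>\<^bsub>N\<^esub>} \<and>
     (\<forall>i. bd F (Suc i) ` carrier (free_mod R (rk F (Suc (Suc i)))) =
       {x \<in> carrier (free_mod R (rk F (Suc i))). bd F i x = \<zero>\<^bsub>free_mod R (rk F i)\<^esub>})"

text \<open>
  Over a Noetherian ring every finitely generated module has such a resolution
  (\<open>free_resolution_exists\<close> below); one is chosen. Only resolutions of modules \<open>R/I\<close> are used.
\<close>

definition resolution ::
    "('r, 'q) ring_scheme \<Rightarrow> ('r, 'n, 'y) module_scheme \<Rightarrow> ('r, 'n) free_complex" where
  "resolution R N = (SOME F. free_resolution R N F)"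

definition cochains ::
    "('r, 'q) ring_scheme \<Rightarrow> ('r, 'n) free_complex \<Rightarrow> ('r, 'm, 'x) module_scheme \<Rightarrow> nat
      \<Rightarrow> ('r, (nat \<Rightarrow> 'r) \<Rightarrow> 'm) module" where
  "cochains R F M i = hom_mod R (free_mod R (rk F i)) M"

definition cocycles ::
    "('r, 'q) ring_scheme \<Rightarrow> ('r, 'n) free_complex \<Rightarrow> ('r, 'm, 'x) module_scheme \<Rightarrow> nat
      \<Rightarrow> ((nat \<Rightarrow> 'r) \<Rightarrow> 'm) set" where
  "cocycles R F M i = {f \<in> carrier (cochains R F M i).
     compose (carrier (free_mod R (rk F (Suc i)))) f (bd F i) = \<zero>\<^bsub>cochains R F M (Suc i)\<^esub>}"

fun coboundaries ::
    "('r, 'q) ring_scheme \<Rightarrow> ('r, 'n) free_complex \<Rightarrow> ('r, 'm, 'x) module_scheme \<Rightarrow> nat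
      \<Rightarrow> ((nat \<Rightarrow> 'r) \<Rightarrow> 'm) set" where
  "coboundaries R F M 0 = {\<zero>\<^bsub>cochains R F M 0\<^esub>}"
| "coboundaries R F M (Suc i) =
     (\<lambda>f. compose (carrier (free_mod R (rk F (Suc i)))) f (bd F i)) ` carrier (cochains R F M i)"

definition Ext ::
    "('r, 'q) ring_scheme \<Rightarrow> nat \<Rightarrow> ('r, 'n, 'y) module_scheme \<Rightarrow> ('r, 'm, 'x) module_scheme
      \<Rightarrow> ('r, ((nat \<Rightarrow> 'r) \<Rightarrow> 'm) set) module" where
  "Ext R i N M = (let F = resolution R N in
     quot_mod ((cochains R F M i)\<lparr>carrier := cocycles R F M i\<rparr>) (coboundaries R F M i))"

text \<open>Chain maps \<open>\<phi> : F \<rightarrow> F'\<close> lifting a linear map \<open>h\<close> between the resolved modules.\<close>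

definition chain_lift ::
    "('r, 'q) ring_scheme \<Rightarrow> ('r, 'n) free_complex \<Rightarrow> ('r, 'p) free_complex \<Rightarrow> ('n \<Rightarrow> 'p)
      \<Rightarrow> (nat \<Rightarrow> (nat \<Rightarrow> 'r) \<Rightarrow> (nat \<Rightarrow> 'r)) \<Rightarrow> bool" where
  "chain_lift R F F' h \<phi> \<longleftrightarrow>
     (\<forall>i. \<phi> i \<in> lin_maps R (free_mod R (rk F i)) (free_mod R (rk F' i))) \<and>
     (\<forall>x\<in>carrier (free_mod R (rk F 0)). aug F' (\<phi> 0 x) = h (aug F x)) \<and>
     (\<forall>i. \<forall>x\<in>carrier (free_mod R (rk F (Suc i))). bd F' i (\<phi> (Suc i) x) = \<phi> i (bd F i x))"

text \<open>
  The map \<open>Ext\<^sup>i(N', M) \<rightarrow> Ext\<^sup>i(N, M)\<close> induced by \<open>h : N \<rightarrow> N'\<close>, i.e. \<open>[f] \<mapsto> [f \<circ> \<phi>\<^sub>i]\<close> on classes,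
  where \<open>\<phi>\<close> is any lift of \<open>h\<close> (one exists by \<open>chain_lift_exists\<close> below, and all of them are homotopic).
\<close>

definition Ext_map ::
    "('r, 'q) ring_scheme \<Rightarrow> nat \<Rightarrow> ('r, 'n, 'y) module_scheme \<Rightarrow> ('r, 'p, 'z) module_scheme
      \<Rightarrow> ('n \<Rightarrow> 'p) \<Rightarrow> ('r, 'm, 'x) module_scheme
      \<Rightarrow> ((nat \<Rightarrow> 'r) \<Rightarrow> 'm) set \<Rightarrow> ((nat \<Rightarrow> 'r) \<Rightarrow> 'm) set" where
  "Ext_map R i N N' h M X = (let F = resolution R N; F' = resolution R N';
       \<phi> = (SOME \<phi>. chain_lift R F F' h \<phi>) in
     coboundaries R F M i <+>\<^bsub>cochains R F M i\<^esub>
       (\<lambda>f. compose (carrier (free_mod R (rk F i))) f (\<phi> i)) ` X)"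

definition quot_pow :: "('r, 'q) ring_scheme \<Rightarrow> 'r set \<Rightarrow> nat \<Rightarrow> ('r, 'r set) module" where
  "quot_pow R \<aa> t = quot_mod (ring_mod R) (\<aa> [^]\<^bsub>ideals_set R\<^esub> t)"

text \<open>
  \<open>H\<^sup>i\<^sub>\<aa>(M)\<close> is the direct limit of the modules \<open>Ext\<^sup>i(R/\<aa>\<^sup>t, M)\<close> along the projections
  \<open>R/\<aa>\<^sup>t \<rightarrow> R/\<aa>\<^sup>s\<close> for \<open>s \<le> t\<close>, which are given on cosets by \<open>X \<mapsto> \<aa>\<^sup>s + X\<close>.
\<close>

definition local_cohomology ::
    "('r, 'q) ring_scheme \<Rightarrow> 'r set \<Rightarrow> nat \<Rightarrow> ('r, 'm, 'x) module_scheme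
      \<Rightarrow> ('r, (nat \<times> ((nat \<Rightarrow> 'r) \<Rightarrow> 'm) set) set) module" where
  "local_cohomology R \<aa> i M = dirlim (\<lambda>t. Ext R i (quot_pow R \<aa> t) M)
     (\<lambda>s t. Ext_map R i (quot_pow R \<aa> t) (quot_pow R \<aa> s)
        (\<lambda>X. (\<aa> [^]\<^bsub>ideals_set R\<^esub> s) <+>\<^bsub>R\<^esub> X) M)"

definition depth ::
    "('r, 'q) ring_scheme \<Rightarrow> 'r set \<Rightarrow> ('r, 'm, 'x) module_scheme \<Rightarrow> enat" where
  "depth R \<bb> M = (let E = (\<lambda>i. Ext R i (quot_mod (ring_mod R) \<bb>) M) in
     Inf {enat i | i. carrier (E i) \<noteq> {\<zero>\<^bsub>E i\<^esub>}})"


section \<open>Support, dimension, and the invariants\<close>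

text \<open>
  The localisation \<open>M\<^sub>\<pp>\<close> consists of the classes of fractions \<open>x/s\<close> with \<open>s \<notin> \<pp>\<close>; only its underlying
  set is needed, to say that it is non-zero.
\<close>

definition fraction_rel ::
    "('r, 'q) ring_scheme \<Rightarrow> ('r, 'm, 'x) module_scheme \<Rightarrow> 'r set \<Rightarrow> (('m \<times> 'r) \<times> ('m \<times> 'r)) set"
    where
  "fraction_rel R M \<pp> = {((x, s), (y, t)).
     x \<in> carrier M \<and> s \<in> carrier R - \<pp> \<and> y \<in> carrier M \<and> t \<in> carrier R - \<pp> \<and>
     (\<exists>u\<in>carrier R - \<pp>. u \<odot>\<^bsub>M\<^esub> (t \<odot>\<^bsub>M\<^esub> x) = u \<odot>\<^bsub>M\<^esub> (s \<odot>\<^bsub>M\<^esub> y))}"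

definition localisation ::
    "('r, 'q) ring_scheme \<Rightarrow> ('r, 'm, 'x) module_scheme \<Rightarrow> 'r set \<Rightarrow> ('m \<times> 'r) set set" where
  "localisation R M \<pp> = (carrier M \<times> (carrier R - \<pp>)) // fraction_rel R M \<pp>"

definition Supp ::
    "('r, 'q) ring_scheme \<Rightarrow> ('r, 'm, 'x) module_scheme \<Rightarrow> 'r set set" where
  "Supp R M = {\<pp>. primeideal \<pp> R \<and>
     localisation R M \<pp> \<noteq> {fraction_rel R M \<pp> `` {(\<zero>\<^bsub>M\<^esub>, \<one>\<^bsub>R\<^esub>)}}}"

text \<open>
  The dimension of a set of primes: the supremum of the lengths \<open>k\<close> of chains
  \<open>\<pp>\<^sub>0 \<subset> \<dots> \<subset> \<pp>\<^sub>k\<close> in it. The empty set has dimension \<open>-\<infinity>\<close>.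
\<close>

definition chain_dim :: "'r set set \<Rightarrow> ereal" where
  "chain_dim X = Sup {ereal (real k) | k.
     \<exists>P :: nat \<Rightarrow> 'r set. (\<forall>i\<le>k. P i \<in> X) \<and> (\<forall>i<k. P i \<subset> P (Suc i))}"

definition in_dim_less ::
    "('r, 'q) ring_scheme \<Rightarrow> nat \<Rightarrow> ('r, 'm, 'x) module_scheme \<Rightarrow> bool" where
  "in_dim_less R n L \<longleftrightarrow> (\<exists>N. submodule N R L \<and> finitely_generated R (L\<lparr>carrier := N\<rparr>) \<and>
     chain_dim (Supp R (quot_mod L N)) < ereal (real n))"

text \<open>The invariants \<open>h\<^sub>\<aa>\<^sup>n(M)\<close> and \<open>h\<^sub>\<aa>\<^sup>\<bb>(M)\<^sup>n\<close>.\<close>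

definition h_dim ::
    "('r, 'q) ring_scheme \<Rightarrow> 'r set \<Rightarrow> nat \<Rightarrow> ('r, 'm, 'x) module_scheme \<Rightarrow> enat" where
  "h_dim R \<aa> n M = Inf {enat i | i. \<not> in_dim_less R n (local_cohomology R \<aa> i M)}"

definition h_dim_rel ::
    "('r, 'q) ring_scheme \<Rightarrow> 'r set \<Rightarrow> 'r set \<Rightarrow> nat \<Rightarrow> ('r, 'm, 'x) module_scheme \<Rightarrow> enat" where
  "h_dim_rel R \<aa> \<bb> n M = Inf {enat i | i. \<forall>t\<ge>1. let H = local_cohomology R \<aa> i M in
     \<not> in_dim_less R n (H\<lparr>carrier := ideal_smult R (\<bb> [^]\<^bsub>ideals_set R\<^esub> (t::nat)) H\<rparr>)}"


section \<open>Existence of the chosen resolutions and lifts\<close>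

lemma lin_mapsD:
  assumes "f \<in> lin_maps R M N"
  shows "f \<in> carrier M \<rightarrow>\<^sub>E carrier N"
    and "x \<in> carrier M \<Longrightarrow> f x \<in> carrier N"
    and "\<lbrakk>x \<in> carrier M; y \<in> carrier M\<rbrakk> \<Longrightarrow> f (x \<oplus>\<^bsub>M\<^esub> y) = f x \<oplus>\<^bsub>N\<^esub> f y"
    and "\<lbrakk>r \<in> carrier R; x \<in> carrier M\<rbrakk> \<Longrightarrow> f (r \<odot>\<^bsub>M\<^esub> x) = r \<odot>\<^bsub>N\<^esub> f x"
  using assms by (auto simp: lin_maps_def)

lemma free_mod_simps [simp]:
  "carrier (free_mod R k) = {..<k} \<rightarrow>\<^sub>E carrier R"
  "\<zero>\<^bsub>free_mod R k\<^esub> = (\<lambda>i\<in>{..<k}. \<zero>\<^bsub>R\<^esub>)"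
  "x \<oplus>\<^bsub>free_mod R k\<^esub> y = (\<lambda>i\<in>{..<k}. x i \<oplus>\<^bsub>R\<^esub> y i)"
  "r \<odot>\<^bsub>free_mod R k\<^esub> x = (\<lambda>i\<in>{..<k}. r \<otimes>\<^bsub>R\<^esub> x i)"
  by (simp_all add: free_mod_def)

lemma free_mod_module:
  fixes R (structure)
  assumes "cring R" shows "module R (free_mod R k)"
proof -
  interpret cring R by fact
  show ?thesis
  proof (rule moduleI)
    show "abelian_group (free_mod R k)"
    proof (rule abelian_groupI)
      fix x assume x: "x \<in> carrier (free_mod R k)"
      show "\<exists>y\<in>carrier (free_mod R k). y \<oplus>\<^bsub>free_mod R k\<^esub> x = \<zero>\<^bsub>free_mod R k\<^esub>"
        using x by (intro bexI[of _ "\<lambda>i\<in>{..<k}. \<ominus> x i"]) (auto simp: PiE_iff l_neg intro!: restrict_ext)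
      show "\<zero>\<^bsub>free_mod R k\<^esub> \<oplus>\<^bsub>free_mod R k\<^esub> x = x"
        using x by (auto simp: PiE_iff extensional_def)
    qed (auto simp: PiE_iff a_ac intro!: restrict_ext)
  next
    fix x assume "x \<in> carrier (free_mod R k)"
    then show "\<one> \<odot>\<^bsub>free_mod R k\<^esub> x = x"
      by (auto simp: PiE_iff extensional_def)
  qed (use assms in \<open>auto simp: PiE_iff l_distr r_distr m_assoc intro!: restrict_ext\<close>)
qed

context module
begin

lemma submodule_zero: "submodule H R M \<Longrightarrow> \<zero>\<^bsub>M\<^esub> \<in> H"
  using subgroup.one_closed[OF submodule.axioms(1)] by fastforce

lemma submod_gen_submodule:
  assumes "A \<subseteq> carrier M" shows "submodule (submod_gen R M A) R M"
proof (rule submoduleI)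
  show "submod_gen R M A \<subseteq> carrier M"
    unfolding submod_gen_def using carrier_is_submodule assms by blast
  show "\<zero>\<^bsub>M\<^esub> \<in> submod_gen R M A"
    unfolding submod_gen_def using submodule_zero by blast
  show "\<ominus>\<^bsub>M\<^esub> x \<in> submod_gen R M A" if "x \<in> submod_gen R M A" for x
    using that unfolding submod_gen_def using submoduleE(3) by blast
  show "x \<oplus>\<^bsub>M\<^esub> y \<in> submod_gen R M A" if "x \<in> submod_gen R M A" "y \<in> submod_gen R M A" for x y
    using that unfolding submod_gen_def using submoduleE(5) by blast
  show "r \<odot>\<^bsub>M\<^esub> x \<in> submod_gen R M A" if "r \<in> carrier R" "x \<in> submod_gen R M A" for r x
    using that unfolding submod_gen_def using submoduleE(4) by blast
qed

lemma submod_gen_incl: "A \<subseteq> submod_gen R M A"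
  by (auto simp: submod_gen_def)

lemma submod_gen_min: "\<lbrakk>submodule H R M; A \<subseteq> H\<rbrakk> \<Longrightarrow> submod_gen R M A \<subseteq> H"
  by (auto simp: submod_gen_def)

lemma lin_maps_zero:
  assumes "module R N" "f \<in> lin_maps R M N" shows "f \<zero>\<^bsub>M\<^esub> = \<zero>\<^bsub>N\<^esub>"
  using lin_mapsD(2,4)[OF assms(2)] module.smult_l_null[OF assms(1)] smult_l_null
  by (metis M.zero_closed R.zero_closed)

lemma lin_maps_a_inv:
  assumes "module R N" "f \<in> lin_maps R M N" "x \<in> carrier M" shows "f (\<ominus>\<^bsub>M\<^esub> x) = \<ominus>\<^bsub>N\<^esub> f x"
  using lin_mapsD(2,4)[OF assms(2)] module.smult_l_minus[OF assms(1)] smult_l_minus assms(3)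
  by (metis R.add.inv_closed R.one_closed assms(1) module.smult_one smult_one)

lemma kernel_submodule:
  assumes "module R N" "f \<in> lin_maps R M N"
  shows "submodule {x \<in> carrier M. f x = \<zero>\<^bsub>N\<^esub>} R M"
proof -
  interpret N: module R N by fact
  show ?thesis
    by (rule submoduleI)
       (auto simp: lin_maps_zero[OF assms] lin_maps_a_inv[OF assms] lin_mapsD[OF assms(2)])
qed

lemma image_submodule:
  assumes "module R N" "f \<in> lin_maps R M N" "submodule H R M"
  shows "submodule (f ` H) R N"
proof -
  interpret N: module R N by fact
  note H = submoduleE[OF assms(3)] submodule_zero[OF assms(3)]
  show ?thesis
  proof (rule N.submoduleI)
    show "f ` H \<subseteq> carrier N" using H(1) lin_mapsD(2)[OF assms(2)] by auto
    show "\<zero>\<^bsub>N\<^esub> \<in> f ` H" using lin_maps_zero[OF assms(1,2)] H(7) by force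
    show "\<ominus>\<^bsub>N\<^esub> a \<in> f ` H" if "a \<in> f ` H" for a
      using that lin_maps_a_inv[OF assms(1,2), symmetric] H(1,3) by (auto intro!: imageI)
    show "a \<oplus>\<^bsub>N\<^esub> b \<in> f ` H" if ab: "a \<in> f ` H" "b \<in> f ` H" for a b
    proof -
      obtain x y where xy: "x \<in> H" "a = f x" "y \<in> H" "b = f y" using ab by blast
      then have "a \<oplus>\<^bsub>N\<^esub> b = f (x \<oplus>\<^bsub>M\<^esub> y)"
        using lin_mapsD(3)[OF assms(2), of x y] subsetD[OF H(1)] by simp
      then show ?thesis using H(5) xy by blast
    qed
    show "a \<odot>\<^bsub>N\<^esub> b \<in> f ` H" if ab: "a \<in> carrier R" "b \<in> f ` H" for a b
    proof -
      obtain y where y: "y \<in> H" "b = f y" using ab by blast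
      then have "a \<odot>\<^bsub>N\<^esub> b = f (a \<odot>\<^bsub>M\<^esub> y)" using lin_mapsD(4)[OF assms(2)] H(1) ab by auto
      then show ?thesis using H(4) y ab by blast
    qed
  qed
qed

lemma free_mod_universal:
  assumes v: "\<And>i. i < k \<Longrightarrow> v i \<in> carrier M"
  shows "\<exists>f\<in>lin_maps R (free_mod R k) M.
    \<forall>i<k. f (\<lambda>j\<in>{..<k}. if j = i then \<one> else \<zero>) = v i"
proof (intro bexI allI impI)
  let ?f = "\<lambda>x\<in>{..<k} \<rightarrow>\<^sub>E carrier R. \<Oplus>\<^bsub>M\<^esub>i\<in>{..<k}. x i \<odot>\<^bsub>M\<^esub> v i"
  show "?f \<in> lin_maps R (free_mod R k) M"
    unfolding lin_maps_def
  proof (safe, goal_cases)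
    case (1 x) then show ?case using v by (auto simp: PiE_iff intro!: M.finsum_closed)
  next
    case (2 x) then show ?case by auto
  next
    case (3 x y)
    have "(\<Oplus>\<^bsub>M\<^esub>i\<in>{..<k}. (\<lambda>i\<in>{..<k}. x i \<oplus> y i) i \<odot>\<^bsub>M\<^esub> v i)
        = (\<Oplus>\<^bsub>M\<^esub>i\<in>{..<k}. x i \<odot>\<^bsub>M\<^esub> v i \<oplus>\<^bsub>M\<^esub> y i \<odot>\<^bsub>M\<^esub> v i)"
      by (rule M.finsum_cong') (use 3 v in \<open>auto simp: PiE_iff smult_l_distr\<close>)
    also have "\<dots> = (\<Oplus>\<^bsub>M\<^esub>i\<in>{..<k}. x i \<odot>\<^bsub>M\<^esub> v i) \<oplus>\<^bsub>M\<^esub> (\<Oplus>\<^bsub>M\<^esub>i\<in>{..<k}. y i \<odot>\<^bsub>M\<^esub> v i)"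
      by (rule M.finsum_addf) (use 3 v in \<open>auto simp: PiE_iff\<close>)
    finally show ?case using 3 by (simp add: PiE_iff)
  next
    case (4 r x)
    have "(\<Oplus>\<^bsub>M\<^esub>i\<in>{..<k}. (\<lambda>i\<in>{..<k}. r \<otimes> x i) i \<odot>\<^bsub>M\<^esub> v i)
        = (\<Oplus>\<^bsub>M\<^esub>i\<in>{..<k}. r \<odot>\<^bsub>M\<^esub> (x i \<odot>\<^bsub>M\<^esub> v i))"
      by (rule M.finsum_cong') (use 4 v in \<open>auto simp: PiE_iff smult_assoc1\<close>)
    also have "\<dots> = r \<odot>\<^bsub>M\<^esub> (\<Oplus>\<^bsub>M\<^esub>i\<in>{..<k}. x i \<odot>\<^bsub>M\<^esub> v i)"
      by (rule finsum_smult_ldistr[symmetric]) (use 4 v in \<open>auto simp: PiE_iff\<close>)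
    finally show ?case using 4 by (simp add: PiE_iff)
  qed
  show "?f (\<lambda>j\<in>{..<k}. if j = i then \<one> else \<zero>) = v i" if "i < k" for i
  proof -
    have "(\<Oplus>\<^bsub>M\<^esub>j\<in>{..<k}. (\<lambda>j\<in>{..<k}. if j = i then \<one> else \<zero>) j \<odot>\<^bsub>M\<^esub> v j)
        = (\<Oplus>\<^bsub>M\<^esub>j\<in>{..<k}. if i = j then v j else \<zero>\<^bsub>M\<^esub>)"
      by (rule M.finsum_cong') (use v in auto)
    also have "\<dots> = v i"
      by (rule M.finsum_singleton) (use v that in auto)
    finally show ?thesis by auto
  qed
qed

end

lemma free_mod_basis_generates:
  fixes R (structure)
  assumes "cring R" and H: "submodule H R (free_mod R k)"
    and e: "\<And>i. i < k \<Longrightarrow> (\<lambda>j\<in>{..<k}. if j = i then \<one> else \<zero>) \<in> H"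
  shows "H = carrier (free_mod R k)"
proof -
  interpret cring R by fact
  interpret F: module R "free_mod R k" by (rule free_mod_module) fact
  have *: "(\<lambda>j\<in>{..<k}. if j < m then x j else \<zero>) \<in> H"
    if x: "x \<in> carrier (free_mod R k)" and "m \<le> k" for x m
    using \<open>m \<le> k\<close>
  proof (induction m)
    case 0 then show ?case using F.submodule_zero[OF H] by (simp add: restrict_def)
  next
    case (Suc m)
    let ?e = "\<lambda>j\<in>{..<k}. if j = m then \<one> else \<zero>"
    have "(\<lambda>j\<in>{..<k}. if j < m then x j else \<zero>) \<oplus>\<^bsub>free_mod R k\<^esub> (x m \<odot>\<^bsub>free_mod R k\<^esub> ?e) \<in> H"
      using Suc.IH Suc.prems x
      by (intro F.submoduleE(4,5)[OF H] e) (auto simp: PiE_iff simp del: restrict_apply)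
    also have "(\<lambda>j\<in>{..<k}. if j < m then x j else \<zero>) \<oplus>\<^bsub>free_mod R k\<^esub> (x m \<odot>\<^bsub>free_mod R k\<^esub> ?e)
      = (\<lambda>j\<in>{..<k}. if j < Suc m then x j else \<zero>)"
      using x Suc.prems by (auto simp: PiE_iff less_Suc_eq intro!: restrict_ext)
    finally show ?case .
  qed
  show ?thesis
  proof
    show "H \<subseteq> carrier (free_mod R k)" using F.submoduleE(1)[OF H] .
    show "carrier (free_mod R k) \<subseteq> H"
    proof
      fix x assume x: "x \<in> carrier (free_mod R k)"
      have "(\<lambda>j\<in>{..<k}. if j < k then x j else \<zero>) = x"
        using x by (auto simp: PiE_iff extensional_def)
      then show "x \<in> H" using *[OF x, of k] by simp
    qed
  qed
qed

lemma free_mod_noetherian: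
  fixes R (structure)
  assumes "cring R" "noetherian_ring R" and K: "submodule K R (free_mod R k)"
  shows "\<exists>A. finite A \<and> A \<subseteq> K \<and> submod_gen R (free_mod R k) A = K"
proof -
  interpret cring R by fact
  interpret noetherian_ring R by fact
  let ?F = "free_mod R k"
  interpret F: module R ?F by (rule free_mod_module) fact
  note KE = F.submoduleE[OF K] F.submodule_zero[OF K]
  have "\<exists>A. finite A \<and> A \<subseteq> K \<and> {x \<in> K. \<forall>i. m \<le> i \<and> i < k \<longrightarrow> x i = \<zero>} \<subseteq> submod_gen R ?F A"
    if "m \<le> k" for m
    using that
  proof (induction m)
    case 0
    have "{x \<in> K. \<forall>i. 0 \<le> i \<and> i < k \<longrightarrow> x i = \<zero>} \<subseteq> {\<zero>\<^bsub>?F\<^esub>}"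
    proof
      fix x assume "x \<in> {x \<in> K. \<forall>i. 0 \<le> i \<and> i < k \<longrightarrow> x i = \<zero>}"
      then have x: "x \<in> {..<k} \<rightarrow>\<^sub>E carrier R" "\<And>i. i < k \<Longrightarrow> x i = \<zero>" using KE(1) by auto
      have "x = (\<lambda>i\<in>{..<k}. \<zero>)" using x(2) PiE_arb[OF x(1)] by (fastforce simp: restrict_def)
      then show "x \<in> {\<zero>\<^bsub>?F\<^esub>}" by simp
    qed
    then show ?case
      using F.submodule_zero[OF F.submod_gen_submodule, of "{}"] by (intro exI[of _ "{}"]) auto
  next
    case (Suc m)
    then have m: "m < k" by simp
    define L where "L = {x \<in> K. \<forall>i. Suc m \<le> i \<and> i < k \<longrightarrow> x i = \<zero>}"
    have coord: "x m \<in> carrier R" if "x \<in> carrier ?F" for x using that m by (auto simp: PiE_iff)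
    have ideal: "ideal ((\<lambda>x. x m) ` H) R" if H: "submodule H R ?F" for H
    proof -
      note HE = F.submoduleE[OF H] F.submodule_zero[OF H]
      have "\<zero> \<in> (\<lambda>x. x m) ` H" using HE(7) m by (force intro: rev_image_eqI)
      moreover have "\<ominus> a \<in> (\<lambda>x. x m) ` H" if ab: "a \<in> (\<lambda>x. x m) ` H" for a
      proof -
        obtain x where x: "x \<in> H" "a = x m" using ab by blast
        then have "x m \<in> carrier R" using HE(1) coord by blast
        then have "\<ominus> a = ((\<ominus> \<one>) \<odot>\<^bsub>?F\<^esub> x) m" using m x by (simp add: l_minus)
        then show ?thesis using HE(4)[of "\<ominus> \<one>" x] x by blast
      qed
      moreover have "a \<oplus> b \<in> (\<lambda>x. x m) ` H" if ab: "a \<in> (\<lambda>x. x m) ` H" "b \<in> (\<lambda>x. x m) ` H" for a b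
      proof -
        obtain x y where x: "x \<in> H" "a = x m" "y \<in> H" "b = y m" using ab by blast
        then have "a \<oplus> b = (x \<oplus>\<^bsub>?F\<^esub> y) m" using m by simp
        then show ?thesis using HE(5) x by blast
      qed
      moreover have "r \<otimes> a \<in> (\<lambda>x. x m) ` H" if ab: "a \<in> (\<lambda>x. x m) ` H" "r \<in> carrier R" for a r
      proof -
        obtain x where x: "x \<in> H" "a = x m" using ab by blast
        then have "r \<otimes> a = (r \<odot>\<^bsub>?F\<^esub> x) m" using m by simp
        then show ?thesis using HE(4) x ab by blast
      qed
      moreover have "(\<lambda>x. x m) ` H \<subseteq> carrier R" using HE(1) coord by blast
      ultimately show ?thesis
        by (intro idealI subgroup.intro ring_axioms)
           (auto simp: m_comm a_inv_def[symmetric] subset_iff)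
    qed
    have L: "submodule L R ?F"
    proof (rule F.submoduleI)
      show "\<ominus>\<^bsub>?F\<^esub> x \<in> L" if "x \<in> L" for x
      proof -
        have x: "x \<in> carrier ?F" using that KE(1) L_def by auto
        then have "\<ominus>\<^bsub>?F\<^esub> x = (\<ominus> \<one>) \<odot>\<^bsub>?F\<^esub> x"
          using F.smult_l_minus[OF one_closed x] F.smult_one[OF x] by simp
        moreover have "(\<ominus> \<one>) \<odot>\<^bsub>?F\<^esub> x \<in> K" using KE(4) that by (simp add: L_def)
        ultimately show ?thesis using that by (simp add: L_def)
      qed
      show "x \<oplus>\<^bsub>?F\<^esub> y \<in> L" if "x \<in> L" "y \<in> L" for x y
        using KE(5)[of x y] that by (simp add: L_def)
      show "r \<odot>\<^bsub>?F\<^esub> x \<in> L" if "r \<in> carrier R" "x \<in> L" for r x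
        using KE(4)[of r x] that by (simp add: L_def)
    qed (use KE in \<open>auto simp: L_def\<close>)
    obtain A where A: "A \<subseteq> carrier R" "finite A" "(\<lambda>x. x m) ` L = Idl A"
      using finetely_gen[OF ideal[OF L]] by blast
    have "A \<subseteq> (\<lambda>x. x m) ` L" using genideal_self[OF A(1)] A(3) by simp
    then obtain C where C: "C \<subseteq> L" "finite C" "A = (\<lambda>x. x m) ` C"
      using finite_subset_image[OF A(2)] by metis
    obtain B where B: "finite B" "B \<subseteq> K"
        "{x \<in> K. \<forall>i. m \<le> i \<and> i < k \<longrightarrow> x i = \<zero>} \<subseteq> submod_gen R ?F B"
      using Suc by auto
    have sub: "B \<union> C \<subseteq> carrier ?F" using B(2) C(1) KE(1) L_def by blast
    let ?G = "submod_gen R ?F (B \<union> C)" and ?GC = "submod_gen R ?F C"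
    have G: "submodule ?G R ?F" by (rule F.submod_gen_submodule[OF sub])
    have GC: "submodule ?GC R ?F" using F.submod_gen_submodule sub by simp
    have "?GC \<subseteq> L" by (rule F.submod_gen_min[OF L C(1)])
    have GCG: "?GC \<subseteq> ?G" using F.submod_gen_incl by (intro F.submod_gen_min[OF G]) blast
    have GBG: "submod_gen R ?F B \<subseteq> ?G" using F.submod_gen_incl by (intro F.submod_gen_min[OF G]) blast
    have "(\<lambda>x. x m) ` L \<subseteq> (\<lambda>x. x m) ` ?GC"
      unfolding A(3) C(3) using F.submod_gen_incl
      by (intro genideal_minimal ideal GC image_mono)
    have "L \<subseteq> ?G"
    proof
      fix x assume x: "x \<in> L"
      then obtain y where y: "y \<in> ?GC" "x m = y m"
        using \<open>(\<lambda>x. x m) ` L \<subseteq> (\<lambda>x. x m) ` ?GC\<close> by blast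
      then have yL: "y \<in> L" using \<open>?GC \<subseteq> L\<close> by blast
      have xc: "x \<in> carrier ?F" "y \<in> carrier ?F" using x yL F.submoduleE(1)[OF L] by blast+
      let ?z = "x \<oplus>\<^bsub>?F\<^esub> ((\<ominus> \<one>) \<odot>\<^bsub>?F\<^esub> y)"
      have "?z \<in> L"
        by (intro F.submoduleE(4,5)[OF L] x yL) simp
      moreover have "?z m = \<zero>"
        using m y(2) coord[OF xc(2)] by (simp add: l_minus r_neg)
      ultimately have "?z \<in> {x \<in> K. \<forall>i. m \<le> i \<and> i < k \<longrightarrow> x i = \<zero>}"
        unfolding L_def using le_neq_implies_less Suc_leI by (smt (verit) mem_Collect_eq)
      then have "?z \<in> ?G" using B(3) GBG by blast
      then have "?z \<oplus>\<^bsub>?F\<^esub> y \<in> ?G" using y GCG F.submoduleE(5)[OF G] by blast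
      moreover have "(\<ominus> \<one>) \<odot>\<^bsub>?F\<^esub> y = \<ominus>\<^bsub>?F\<^esub> y"
        using F.smult_l_minus[OF one_closed xc(2)] F.smult_one[OF xc(2)] by simp
      then have "?z \<oplus>\<^bsub>?F\<^esub> y = x"
        using F.M.a_assoc[OF xc(1) F.M.a_inv_closed[OF xc(2)] xc(2)] F.M.l_neg[OF xc(2)]
          F.M.r_zero[OF xc(1)] by metis
      ultimately show "x \<in> ?G" by simp
    qed
    then show ?case
      using B C by (intro exI[of _ "B \<union> C"]) (auto simp: L_def)
  qed
  from this[of k] obtain A where A: "finite A" "A \<subseteq> K"
      "{x \<in> K. \<forall>i. k \<le> i \<and> i < k \<longrightarrow> x i = \<zero>} \<subseteq> submod_gen R ?F A" by blast
  have "{x \<in> K. \<forall>i. k \<le> i \<and> i < k \<longrightarrow> x i = \<zero>} = K" by auto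
  then have "K \<subseteq> submod_gen R ?F A" using A(3) by simp
  then show ?thesis using F.submod_gen_min[OF K A(2)] A by (intro exI[of _ A]) simp
qed

lemma (in module) free_mod_onto:
  assumes "finite A" "A \<subseteq> carrier M"
  obtains k f where "f \<in> lin_maps R (free_mod R k) M"
    and "f ` carrier (free_mod R k) = submod_gen R M A"
proof -
  obtain v k where v: "A = v ` {i::nat. i < k}"
    using \<open>finite A\<close> finite_imp_nat_seg_image_inj_on by metis
  then have vc: "\<And>i. i < k \<Longrightarrow> v i \<in> carrier M" using assms(2) by blast
  obtain f where f: "f \<in> lin_maps R (free_mod R k) M"
      "\<And>i. i < k \<Longrightarrow> f (\<lambda>j\<in>{..<k}. if j = i then \<one> else \<zero>) = v i"
    using free_mod_universal[of k v, OF vc] by metis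
  let ?F = "free_mod R k"
  interpret F: module R ?F by (rule free_mod_module) (rule R.is_cring)
  let ?H = "{x \<in> carrier ?F. f x \<in> submod_gen R M A}"
  note G = submod_gen_submodule[OF assms(2)]
  have "submodule ?H R ?F"
    by (rule F.submoduleI)
       (auto simp: F.lin_maps_zero[OF module_axioms f(1)] F.lin_maps_a_inv[OF module_axioms f(1)]
          lin_mapsD(3,4)[OF f(1)] submodule_zero[OF G] intro: submoduleE(3,4,5)[OF G]
        simp del: free_mod_simps)
  moreover have "(\<lambda>j\<in>{..<k}. if j = i then \<one> else \<zero>) \<in> ?H" if "i < k" for i
  proof -
    have "v i \<in> submod_gen R M A" using v submod_gen_incl[of A] that by blast
    then show ?thesis using f(2)[OF that] by auto
  qed
  ultimately have "?H = carrier ?F"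
    by (intro free_mod_basis_generates R.is_cring)
  then have 1: "f ` carrier ?F \<subseteq> submod_gen R M A" by blast
  have "v i \<in> f ` carrier ?F" if "i < k" for i
    by (rule image_eqI[where f = f, OF f(2)[OF that, symmetric]]) auto
  then have 2: "submod_gen R M A \<subseteq> f ` carrier ?F"
    using v F.image_submodule[OF module_axioms f(1) F.carrier_is_submodule]
    by (intro submod_gen_min) auto
  show ?thesis using that[OF f(1)] 1 2 by blast
qed

theorem free_resolution_exists:
  assumes "cring R" "noetherian_ring R" "module R N" "finitely_generated R N"
  shows "\<exists>F. free_resolution R N F"
proof -
  interpret N: module R N by fact
  have fm: "module R (free_mod R k)" for k by (rule free_mod_module) fact
  have cover: "\<exists>k' g. g \<in> lin_maps R (free_mod R k') (free_mod R k) \<and>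
      g ` carrier (free_mod R k') = K" if "submodule K R (free_mod R k)" for K k
  proof -
    interpret F: module R "free_mod R k" by (rule fm)
    have "\<exists>A. finite A \<and> A \<subseteq> K \<and> submod_gen R (free_mod R k) A = K"
      by (rule free_mod_noetherian[OF assms(1,2) that])
    then obtain A where A: "finite A" "A \<subseteq> K" "submod_gen R (free_mod R k) A = K" by blast
    have "A \<subseteq> carrier (free_mod R k)" using A(2) F.submoduleE(1)[OF that] by (rule subset_trans)
    then obtain k' g where "g \<in> lin_maps R (free_mod R k') (free_mod R k)"
        "g ` carrier (free_mod R k') = submod_gen R (free_mod R k) A"
      by (rule F.free_mod_onto[OF A(1)])
    then show ?thesis using A(3) by blast
  qed
  obtain k0 \<epsilon> where \<epsilon>: "\<epsilon> \<in> lin_maps R (free_mod R k0) N"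
      "\<epsilon> ` carrier (free_mod R k0) = carrier N"
    using assms(4) N.free_mod_onto unfolding finitely_generated_def by metis
  obtain k1 d0 where d0: "d0 \<in> lin_maps R (free_mod R k1) (free_mod R k0)"
      "d0 ` carrier (free_mod R k1) = {x \<in> carrier (free_mod R k0). \<epsilon> x = \<zero>\<^bsub>N\<^esub>}"
    using cover[OF module.kernel_submodule[OF fm assms(3) \<epsilon>(1)]] by blast
  let ?P = "\<lambda>i (k, l, d). d \<in> lin_maps R (free_mod R l) (free_mod R k) \<and>
    (i = (0::nat) \<longrightarrow> (k, l, d) = (k0, k1, d0))"
  let ?Q = "\<lambda>i (k, l, d) (k', l', d'). k' = l \<and> d' ` carrier (free_mod R l') =
    {x \<in> carrier (free_mod R l). d x = \<zero>\<^bsub>free_mod R k\<^esub>}"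
  have "\<exists>s. \<forall>i. ?P i (s i) \<and> ?Q i (s i) (s (Suc i))"
  proof (rule dependent_nat_choice)
    show "\<exists>x. ?P 0 x" using d0(1) by (intro exI[of _ "(k0, k1, d0)"]) simp
    fix x i assume "?P i x"
    obtain k l d where x: "x = (k, l, d)" by (cases x)
    then have d: "d \<in> lin_maps R (free_mod R l) (free_mod R k)" using \<open>?P i x\<close> by simp
    obtain l' g where "g \<in> lin_maps R (free_mod R l') (free_mod R l)"
      "g ` carrier (free_mod R l') = {x \<in> carrier (free_mod R l). d x = \<zero>\<^bsub>free_mod R k\<^esub>}"
      using cover[OF module.kernel_submodule[OF fm fm d]] by blast
    then show "\<exists>y. ?P (Suc i) y \<and> ?Q i x y"
      by (intro exI[of _ "(l, l', g)"]) (simp add: x del: free_mod_simps)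
  qed
  then obtain s where "\<forall>i. ?P i (s i) \<and> ?Q i (s i) (s (Suc i))" by (rule exE)
  then have s: "?P i (s i)" "?Q i (s i) (s (Suc i))" for i
    by (simp_all only: split: prod.splits)
  define F where "F = \<lparr>rk = (\<lambda>i. fst (s i)), bd = (\<lambda>i. snd (snd (s i))), aug = \<epsilon>\<rparr>"
  have rk: "fst (s (Suc i)) = fst (snd (s i))" for i
    using s(2)[of i] by (simp add: case_prod_beta del: free_mod_simps)
  have s0: "s 0 = (k0, k1, d0)" using s(1)[of 0] by (cases "s 0") simp
  have "bd F i \<in> lin_maps R (free_mod R (rk F (Suc i))) (free_mod R (rk F i))" for i
    using s(1)[of i] by (simp add: F_def rk case_prod_beta del: free_mod_simps)
  moreover have "bd F (Suc i) ` carrier (free_mod R (rk F (Suc (Suc i)))) =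
       {x \<in> carrier (free_mod R (rk F (Suc i))). bd F i x = \<zero>\<^bsub>free_mod R (rk F i)\<^esub>}" for i
    using s(2)[of i] rk[of "Suc i"] by (simp add: F_def case_prod_beta del: free_mod_simps)
  moreover have "rk F 0 = k0" "aug F = \<epsilon>" "bd F 0 = d0" "rk F 1 = k1"
    using s0 rk[of 0] by (auto simp: F_def)
  ultimately have "free_resolution R N F"
    using \<epsilon> d0 unfolding free_resolution_def by (simp del: free_mod_simps)
  then show ?thesis ..
qed

lemma free_mod_lift:
  fixes R (structure)
  assumes "cring R" "module R P" "module R L"
    and f: "f \<in> lin_maps R (free_mod R k) L" and g: "g \<in> lin_maps R P L"
    and sub: "f ` carrier (free_mod R k) \<subseteq> g ` carrier P"
  shows "\<exists>\<phi>\<in>lin_maps R (free_mod R k) P. \<forall>x\<in>carrier (free_mod R k). g (\<phi> x) = f x"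
proof -
  let ?F = "free_mod R k" and ?e = "\<lambda>i. \<lambda>j\<in>{..<k}. if j = i then \<one> else \<zero>"
  interpret F: module R ?F by (rule free_mod_module) fact
  interpret P: module R P by fact
  interpret L: module R L by fact
  have ec: "?e i \<in> carrier ?F" for i by auto
  have "\<exists>p. p \<in> carrier P \<and> g p = f (?e i)" for i
    using sub imageI[OF ec, of f i] by (smt (verit, best) imageE subsetD)
  then obtain v where v: "\<And>i. v i \<in> carrier P" "\<And>i. g (v i) = f (?e i)" by metis
  obtain \<phi> where \<phi>: "\<phi> \<in> lin_maps R ?F P" "\<And>i. i < k \<Longrightarrow> \<phi> (?e i) = v i"
    using P.free_mod_universal[of k v, OF v(1)] by metis
  note D = lin_mapsD(2,3,4)[OF \<phi>(1)] lin_mapsD(2,3,4)[OF f] lin_mapsD(2,3,4)[OF g]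
    F.lin_maps_zero[OF assms(2) \<phi>(1)] F.lin_maps_a_inv[OF assms(2) \<phi>(1)]
    F.lin_maps_zero[OF assms(3) f] F.lin_maps_a_inv[OF assms(3) f]
    P.lin_maps_zero[OF assms(3) g] P.lin_maps_a_inv[OF assms(3) g]
  have "submodule {x \<in> carrier ?F. g (\<phi> x) = f x} R ?F"
    by (rule F.submoduleI) (auto simp: D simp del: free_mod_simps)
  moreover have "?e i \<in> {x \<in> carrier ?F. g (\<phi> x) = f x}" if "i < k" for i
    using \<phi>(2)[OF that] v(2) ec by simp
  ultimately have "{x \<in> carrier ?F. g (\<phi> x) = f x} = carrier ?F"
    using free_mod_basis_generates[OF assms(1)] by blast
  then show ?thesis using \<phi>(1) by blast
qed

lemma (in module) lin_maps_comp:
  assumes f: "f \<in> lin_maps R M K"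
    and g: "\<And>x. x \<in> carrier K \<Longrightarrow> g x \<in> carrier L"
      "\<And>x y. \<lbrakk>x \<in> carrier K; y \<in> carrier K\<rbrakk> \<Longrightarrow> g (x \<oplus>\<^bsub>K\<^esub> y) = g x \<oplus>\<^bsub>L\<^esub> g y"
      "\<And>r x. \<lbrakk>r \<in> carrier R; x \<in> carrier K\<rbrakk> \<Longrightarrow> g (r \<odot>\<^bsub>K\<^esub> x) = r \<odot>\<^bsub>L\<^esub> g x"
  shows "(\<lambda>x\<in>carrier M. g (f x)) \<in> lin_maps R M L"
  using g lin_mapsD(2,3,4)[OF f] unfolding lin_maps_def[of R M L] by auto

theorem chain_lift_exists:
  fixes R (structure)
  assumes "cring R" "module R N" "module R N'"
    and F: "free_resolution R N F" and F': "free_resolution R N' F'"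
    and h: "\<And>x. x \<in> carrier N \<Longrightarrow> h x \<in> carrier N'"
      "\<And>x y. \<lbrakk>x \<in> carrier N; y \<in> carrier N\<rbrakk> \<Longrightarrow> h (x \<oplus>\<^bsub>N\<^esub> y) = h x \<oplus>\<^bsub>N'\<^esub> h y"
      "\<And>r x. \<lbrakk>r \<in> carrier R; x \<in> carrier N\<rbrakk> \<Longrightarrow> h (r \<odot>\<^bsub>N\<^esub> x) = r \<odot>\<^bsub>N'\<^esub> h x"
  shows "\<exists>\<phi>. chain_lift R F F' h \<phi>"
proof -
  let ?F = "\<lambda>i. free_mod R (rk F i)" and ?F' = "\<lambda>i. free_mod R (rk F' i)"
  have m: "module R (?F i)" "module R (?F' i)" for i by (rule free_mod_module, fact)+
  interpret N: module R N by fact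
  interpret N': module R N' by fact
  have aug: "aug F \<in> lin_maps R (?F 0) N" "aug F' \<in> lin_maps R (?F' 0) N'"
    and onto: "aug F' ` carrier (?F' 0) = carrier N'"
    and bd: "\<And>i. bd F i \<in> lin_maps R (?F (Suc i)) (?F i)"
      "\<And>i. bd F' i \<in> lin_maps R (?F' (Suc i)) (?F' i)"
    and ex0: "bd F 0 ` carrier (?F (Suc 0)) = {x \<in> carrier (?F 0). aug F x = \<zero>\<^bsub>N\<^esub>}"
      "bd F' 0 ` carrier (?F' (Suc 0)) = {x \<in> carrier (?F' 0). aug F' x = \<zero>\<^bsub>N'\<^esub>}"
    and ex: "\<And>i. bd F (Suc i) ` carrier (?F (Suc (Suc i))) =
        {x \<in> carrier (?F (Suc i)). bd F i x = \<zero>\<^bsub>?F i\<^esub>}"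
      "\<And>i. bd F' (Suc i) ` carrier (?F' (Suc (Suc i))) =
        {x \<in> carrier (?F' (Suc i)). bd F' i x = \<zero>\<^bsub>?F' i\<^esub>}"
    using F F' unfolding free_resolution_def by (simp_all del: free_mod_simps)
  have h0: "h \<zero>\<^bsub>N\<^esub> = \<zero>\<^bsub>N'\<^esub>"
    using h(1)[of "\<zero>\<^bsub>N\<^esub>"] h(3)[of \<zero> "\<zero>\<^bsub>N\<^esub>"] N.smult_l_null N'.smult_l_null
    by (metis N.M.zero_closed N.R.zero_closed)
  let ?P = "\<lambda>i \<phi>. \<phi> \<in> lin_maps R (?F i) (?F' i) \<and>
    (i = 0 \<longrightarrow> (\<forall>x\<in>carrier (?F 0). aug F' (\<phi> x) = h (aug F x))) \<and>
    (\<forall>x\<in>carrier (?F (Suc i)). \<phi> (bd F i x) \<in> bd F' i ` carrier (?F' (Suc i)))"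
  let ?Q = "\<lambda>i \<phi> \<phi>'. \<forall>x\<in>carrier (?F (Suc i)). bd F' i (\<phi>' x) = \<phi> (bd F i x)"
  have "\<exists>\<phi>. \<forall>i. ?P i (\<phi> i) \<and> ?Q i (\<phi> i) (\<phi> (Suc i))"
  proof (rule dependent_nat_choice)
    let ?f = "\<lambda>x\<in>carrier (?F 0). h (aug F x)"
    have f: "?f \<in> lin_maps R (?F 0) N'"
      by (rule module.lin_maps_comp[OF m(1) aug(1)]) (use h in auto)
    have "?f ` carrier (?F 0) \<subseteq> aug F' ` carrier (?F' 0)"
      unfolding onto using lin_mapsD(2)[OF f] by blast
    then obtain \<phi> where \<phi>: "\<phi> \<in> lin_maps R (?F 0) (?F' 0)"
        "\<forall>x\<in>carrier (?F 0). aug F' (\<phi> x) = ?f x"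
      using free_mod_lift[OF assms(1) m(2) assms(3) f aug(2)] by metis
    have "\<phi> (bd F 0 x) \<in> bd F' 0 ` carrier (?F' (Suc 0))" if "x \<in> carrier (?F (Suc 0))" for x
    proof -
      have "bd F 0 x \<in> {x \<in> carrier (?F 0). aug F x = \<zero>\<^bsub>N\<^esub>}" using that ex0(1) by blast
      then show ?thesis
        unfolding ex0(2) using \<phi>(2) h0 lin_mapsD(2)[OF \<phi>(1)] by (simp del: free_mod_simps)
    qed
    then show "\<exists>\<phi>. ?P 0 \<phi>" using \<phi> by (intro exI[of _ \<phi>]) (simp del: free_mod_simps)
  next
    fix \<phi> i assume \<phi>: "?P i \<phi>"
    then have \<phi>l: "\<phi> \<in> lin_maps R (?F i) (?F' i)" by blast
    let ?f = "\<lambda>x\<in>carrier (?F (Suc i)). \<phi> (bd F i x)"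
    have f: "?f \<in> lin_maps R (?F (Suc i)) (?F' i)"
      by (rule module.lin_maps_comp[OF m(1) bd(1)[of i]])
         (use lin_mapsD(2,3,4)[OF \<phi>l] in \<open>auto simp del: free_mod_simps\<close>)
    have "?f ` carrier (?F (Suc i)) \<subseteq> bd F' i ` carrier (?F' (Suc i))"
      using \<phi> by (auto simp del: free_mod_simps)
    then obtain \<psi> where \<psi>: "\<psi> \<in> lin_maps R (?F (Suc i)) (?F' (Suc i))"
        "\<forall>x\<in>carrier (?F (Suc i)). bd F' i (\<psi> x) = ?f x"
      using free_mod_lift[OF assms(1) m(2) m(2) f bd(2)] by metis
    have "\<psi> (bd F (Suc i) x) \<in> bd F' (Suc i) ` carrier (?F' (Suc (Suc i)))"
      if "x \<in> carrier (?F (Suc (Suc i)))" for x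
    proof -
      have "bd F (Suc i) x \<in> {x \<in> carrier (?F (Suc i)). bd F i x = \<zero>\<^bsub>?F i\<^esub>}"
        using that ex(1)[of i] by blast
      then show ?thesis
        unfolding ex(2)
        using \<psi>(2) module.lin_maps_zero[OF m(1) m(2) \<phi>l] lin_mapsD(2)[OF \<psi>(1)]
        by (simp del: free_mod_simps)
    qed
    then show "\<exists>\<psi>. ?P (Suc i) \<psi> \<and> ?Q i \<phi> \<psi>"
      using \<psi> by (intro exI[of _ \<psi>]) (simp del: free_mod_simps)
  qed
  then obtain \<phi> where \<phi>: "\<forall>i. ?P i (\<phi> i) \<and> ?Q i (\<phi> i) (\<phi> (Suc i))" by (rule exE)
  have "chain_lift R F F' h \<phi>"
    unfolding chain_lift_def using \<phi> by (simp del: free_mod_simps)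
  then show ?thesis by (rule exI[of "chain_lift R F F' h"])
qed

lemma (in module) quot_mod_smult:
  assumes N: "submodule N R M" and r: "r \<in> carrier R" and x: "x \<in> carrier M"
  shows "r \<odot>\<^bsub>quot_mod M N\<^esub> (N +>\<^bsub>M\<^esub> x) = N +>\<^bsub>M\<^esub> (r \<odot>\<^bsub>M\<^esub> x)"
proof -
  note NE = submoduleE[OF N] submodule_zero[OF N]
  have "N <+>\<^bsub>M\<^esub> (\<lambda>x. r \<odot>\<^bsub>M\<^esub> x) ` (N +>\<^bsub>M\<^esub> x) = {n \<oplus>\<^bsub>M\<^esub> r \<odot>\<^bsub>M\<^esub> (n' \<oplus>\<^bsub>M\<^esub> x) | n n'. n \<in> N \<and> n' \<in> N}"
    by (auto simp: set_add_def' a_r_coset_def')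
  also have "\<dots> = {(n \<oplus>\<^bsub>M\<^esub> r \<odot>\<^bsub>M\<^esub> n') \<oplus>\<^bsub>M\<^esub> r \<odot>\<^bsub>M\<^esub> x | n n'. n \<in> N \<and> n' \<in> N}"
  proof -
    have "n \<oplus>\<^bsub>M\<^esub> r \<odot>\<^bsub>M\<^esub> (n' \<oplus>\<^bsub>M\<^esub> x) = (n \<oplus>\<^bsub>M\<^esub> r \<odot>\<^bsub>M\<^esub> n') \<oplus>\<^bsub>M\<^esub> r \<odot>\<^bsub>M\<^esub> x"
      if "n \<in> N" "n' \<in> N" for n n'
      using that NE(1) r x by (simp add: subset_iff smult_r_distr M.a_assoc)
    then show ?thesis by (intro Collect_cong iff_exI) (metis (no_types))
  qed
  also have "\<dots> = {n \<oplus>\<^bsub>M\<^esub> r \<odot>\<^bsub>M\<^esub> x | n. n \<in> N}"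
  proof (intro equalityI subsetI; clarify)
    fix n n' assume "n \<in> N" "n' \<in> N"
    then have "n \<oplus>\<^bsub>M\<^esub> r \<odot>\<^bsub>M\<^esub> n' \<in> N" using NE(4,5) r by blast
    then show "\<exists>n''. n \<oplus>\<^bsub>M\<^esub> r \<odot>\<^bsub>M\<^esub> n' \<oplus>\<^bsub>M\<^esub> r \<odot>\<^bsub>M\<^esub> x = n'' \<oplus>\<^bsub>M\<^esub> r \<odot>\<^bsub>M\<^esub> x \<and> n'' \<in> N" by blast
  next
    fix n assume n: "n \<in> N"
    then have "n = n \<oplus>\<^bsub>M\<^esub> r \<odot>\<^bsub>M\<^esub> \<zero>\<^bsub>M\<^esub>" using NE(1) r by (simp add: subset_iff)
    then show "\<exists>n' n''. n \<oplus>\<^bsub>M\<^esub> r \<odot>\<^bsub>M\<^esub> x = n' \<oplus>\<^bsub>M\<^esub> r \<odot>\<^bsub>M\<^esub> n'' \<oplus>\<^bsub>M\<^esub> r \<odot>\<^bsub>M\<^esub> x \<and> n' \<in> N \<and> n'' \<in> N"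
      using n NE(7) by metis
  qed
  finally show ?thesis by (auto simp: quot_mod_def a_r_coset_def')
qed

lemma (in module) quot_mod_module:
  assumes N: "submodule N R M" shows "module R (quot_mod M N)"
proof -
  let ?Q = "quot_mod M N"
  interpret S: abelian_subgroup N M
    using N M.abelian_group_axioms
    by (auto intro!: abelian_subgroupI3 additive_subgroup.intro dest: submodule.axioms(1))
  have car: "carrier ?Q = {N +>\<^bsub>M\<^esub> x | x. x \<in> carrier M}"
    by (auto simp: quot_mod_def A_RCOSETS_def')
  have add: "(N +>\<^bsub>M\<^esub> x) \<oplus>\<^bsub>?Q\<^esub> (N +>\<^bsub>M\<^esub> y) = N +>\<^bsub>M\<^esub> (x \<oplus>\<^bsub>M\<^esub> y)"
    if "x \<in> carrier M" "y \<in> carrier M" for x y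
    using S.a_rcos_sum[OF that] by (simp add: quot_mod_def)
  have zero: "\<zero>\<^bsub>?Q\<^esub> = N +>\<^bsub>M\<^esub> \<zero>\<^bsub>M\<^esub>"
    using M.a_coset_add_zero[OF submoduleE(1)[OF N]] by (simp add: quot_mod_def)
  note smult = quot_mod_smult[OF N]
  have "comm_group (M A_Mod N)" by (rule S.a_factorgroup_is_comm_group)
  show ?thesis
  proof (rule moduleI)
    show "abelian_group ?Q"
    proof (rule abelian_groupI)
      fix X assume "X \<in> carrier ?Q"
      then obtain x where x: "X = N +>\<^bsub>M\<^esub> x" "x \<in> carrier M" using car by auto
      then have "(N +>\<^bsub>M\<^esub> \<ominus>\<^bsub>M\<^esub> x) \<oplus>\<^bsub>?Q\<^esub> X = \<zero>\<^bsub>?Q\<^esub>" by (simp add: add zero M.l_neg)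
      then show "\<exists>Y\<in>carrier ?Q. Y \<oplus>\<^bsub>?Q\<^esub> X = \<zero>\<^bsub>?Q\<^esub>" using car x by blast
    next
      fix X Y Z assume "X \<in> carrier ?Q" "Y \<in> carrier ?Q" "Z \<in> carrier ?Q"
      then show "(X \<oplus>\<^bsub>?Q\<^esub> Y) \<oplus>\<^bsub>?Q\<^esub> Z = X \<oplus>\<^bsub>?Q\<^esub> (Y \<oplus>\<^bsub>?Q\<^esub> Z)"
        unfolding car by (auto simp: add M.a_assoc)
    next
      fix X Y assume "X \<in> carrier ?Q" "Y \<in> carrier ?Q"
      then show "X \<oplus>\<^bsub>?Q\<^esub> Y = Y \<oplus>\<^bsub>?Q\<^esub> X" unfolding car by (auto simp: add M.a_comm)
    next
      fix X Y assume "X \<in> carrier ?Q" "Y \<in> carrier ?Q"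
      then show "X \<oplus>\<^bsub>?Q\<^esub> Y \<in> carrier ?Q" unfolding car by (auto simp: add)
    next
      fix X assume "X \<in> carrier ?Q"
      then show "\<zero>\<^bsub>?Q\<^esub> \<oplus>\<^bsub>?Q\<^esub> X = X" unfolding car zero by (auto simp: add)
    next
      show "\<zero>\<^bsub>?Q\<^esub> \<in> carrier ?Q" unfolding car zero by blast
    qed
    show "cring R" by (rule R.is_cring)
  qed (unfold car, auto simp: smult add smult_l_distr smult_r_distr smult_assoc1)
qed

lemma ring_mod_simps [simp]:
  "carrier (ring_mod R) = carrier R" "\<zero>\<^bsub>ring_mod R\<^esub> = \<zero>\<^bsub>R\<^esub>"
  "x \<oplus>\<^bsub>ring_mod R\<^esub> y = x \<oplus>\<^bsub>R\<^esub> y" "r \<odot>\<^bsub>ring_mod R\<^esub> x = r \<otimes>\<^bsub>R\<^esub> x"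
  by (simp_all add: ring_mod_def)

lemma (in cring) ring_mod_module: "module R (ring_mod R)"
proof (rule moduleI)
  show "abelian_group (ring_mod R)"
    by (rule abelian_groupI) (auto simp: a_ac intro: bexI[of _ "\<ominus> _"] l_neg)
qed (auto simp: is_cring l_distr r_distr m_assoc)

lemma (in cring) ideal_submodule:
  assumes "ideal I R" shows "submodule I R (ring_mod R)"
proof -
  interpret ideal I R by fact
  interpret RM: module R "ring_mod R" by (rule ring_mod_module)
  show ?thesis
  proof (rule RM.submoduleI)
    fix a assume a: "a \<in> I"
    then have "\<ominus>\<^bsub>ring_mod R\<^esub> a = (\<ominus> \<one>) \<otimes> a"
      using RM.smult_l_minus[of \<one> a] a_subset by (simp add: subset_iff)
    then show "\<ominus>\<^bsub>ring_mod R\<^esub> a \<in> I" using a I_l_closed by simp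
  qed (use a_subset I_l_closed in auto)
qed

lemma (in cring) quot_ring_finitely_generated:
  assumes I: "ideal I R" shows "finitely_generated R (quot_mod (ring_mod R) I)"
proof -
  interpret RM: module R "ring_mod R" by (rule ring_mod_module)
  let ?Q = "quot_mod (ring_mod R) I"
  note sub = ideal_submodule[OF I]
  interpret Q: module R ?Q by (rule RM.quot_mod_module[OF sub])
  have car: "carrier ?Q = {I +>\<^bsub>ring_mod R\<^esub> x | x. x \<in> carrier R}"
    by (auto simp: quot_mod_def A_RCOSETS_def')
  let ?A = "{I +>\<^bsub>ring_mod R\<^esub> \<one>}"
  have A: "?A \<subseteq> carrier ?Q" using car by auto
  note G = Q.submod_gen_submodule[OF A]
  have "carrier ?Q \<subseteq> submod_gen R ?Q ?A"
  proof
    fix X assume "X \<in> carrier ?Q"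
    then obtain x where x: "x \<in> carrier R" "X = I +>\<^bsub>ring_mod R\<^esub> x" using car by auto
    then have "X = x \<odot>\<^bsub>?Q\<^esub> (I +>\<^bsub>ring_mod R\<^esub> \<one>)" by (simp add: RM.quot_mod_smult[OF sub])
    then show "X \<in> submod_gen R ?Q ?A"
      using Q.submoduleE(4)[OF G] Q.submod_gen_incl[of ?A] x(1) by blast
  qed
  then show ?thesis
    unfolding finitely_generated_def using A Q.submoduleE(1)[OF G] by (intro exI[of _ ?A]) auto
qed

theorem resolution_quot_ring:
  assumes "cring R" "noetherian_ring R" "ideal I R"
  shows "free_resolution R (quot_mod (ring_mod R) I) (resolution R (quot_mod (ring_mod R) I))"
proof -
  interpret cring R by fact
  show ?thesis
    unfolding resolution_def
    by (rule someI_ex, rule free_resolution_exists[OF assms(1,2)])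
       (rule module.quot_mod_module[OF ring_mod_module ideal_submodule[OF assms(3)]],
        rule quot_ring_finitely_generated[OF assms(3)])
qed

theorem lift_quot_ring_exists:
  fixes R (structure)
  assumes "cring R" "noetherian_ring R" "ideal I R" "ideal J R" "I \<subseteq> J"
  shows "\<exists>\<phi>. chain_lift R (resolution R (quot_mod (ring_mod R) I))
    (resolution R (quot_mod (ring_mod R) J)) (\<lambda>X. J <+> X) \<phi>"
proof -
  interpret cring R by fact
  interpret RM: module R "ring_mod R" by (rule ring_mod_module)
  have "(+>\<^bsub>ring_mod R\<^esub>) = (+>)" by (simp add: a_r_coset_def r_coset_def ring_mod_def fun_eq_iff)
  have car: "carrier (quot_mod (ring_mod R) K) = {K +>\<^bsub>ring_mod R\<^esub> x | x. x \<in> carrier R}" for K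
    by (auto simp: quot_mod_def A_RCOSETS_def')
  have add: "(K +>\<^bsub>ring_mod R\<^esub> x) \<oplus>\<^bsub>quot_mod (ring_mod R) K\<^esub> (K +>\<^bsub>ring_mod R\<^esub> y) = K +>\<^bsub>ring_mod R\<^esub> (x \<oplus> y)"
    if "ideal K R" "x \<in> carrier R" "y \<in> carrier R" for K x y
  proof -
    interpret S: abelian_subgroup K "ring_mod R"
      using ideal_submodule[OF that(1)]
        RM.M.abelian_group_axioms
      by (auto intro!: abelian_subgroupI3 additive_subgroup.intro dest: submodule.axioms(1))
    show ?thesis using S.a_rcos_sum[of x y] that(2,3) by (simp add: quot_mod_def)
  qed
  have proj: "J <+> (I +>\<^bsub>ring_mod R\<^esub> x) = J +>\<^bsub>ring_mod R\<^esub> x" if x: "x \<in> carrier R" for x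
  proof -
    interpret I: ideal I R by fact
    interpret J: ideal J R by fact
    have "J <+> (I +>\<^bsub>ring_mod R\<^esub> x) = {j \<oplus> (i \<oplus> x) | i j. i \<in> I \<and> j \<in> J}"
      by (auto simp: set_add_def' a_r_coset_def')
    also have "\<dots> = {j \<oplus> x | j. j \<in> J}"
    proof (intro equalityI subsetI; clarify)
      fix i j assume ij: "i \<in> I" "j \<in> J"
      then have "j \<oplus> (i \<oplus> x) = (j \<oplus> i) \<oplus> x" "j \<oplus> i \<in> J"
        using x assms(5) by (auto simp: a_assoc)
      then show "\<exists>j'. j \<oplus> (i \<oplus> x) = j' \<oplus> x \<and> j' \<in> J" by blast
    next
      fix j assume j: "j \<in> J"
      have "j \<oplus> x = j \<oplus> (\<zero> \<oplus> x)" "\<zero> \<in> I" using x by auto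
      then show "\<exists>i j'. j \<oplus> x = j' \<oplus> (i \<oplus> x) \<and> i \<in> I \<and> j' \<in> J" using j by blast
    qed
    finally show ?thesis by (auto simp: a_r_coset_def')
  qed
  show ?thesis
  proof (rule chain_lift_exists[OF assms(1)])
    show "module R (quot_mod (ring_mod R) I)" "module R (quot_mod (ring_mod R) J)"
      by (intro RM.quot_mod_module ideal_submodule assms)+
  qed (use assms in \<open>auto simp: car proj add RM.quot_mod_smult[OF ideal_submodule] intro!: resolution_quot_ring\<close>)
qed

end

theory Submission
  imports Defs
begin

text \<open>
  Both inequalities always hold: \<open>H\<^sup>i\<^sub>\<aa>(M) = 0\<close> for \<open>i < depth(\<bb>, M)\<close>, and a zero module is in
  dimension \<open>< n\<close>. It suffices that \<open>Ext\<^sup>i(R/\<bb>, M) = 0\<close> for \<open>i < d\<close> implies \<open>Ext\<^sup>i(R/J, M) = 0\<close> for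
  \<open>i < d\<close> whenever \<open>J\<close> contains \<open>C = \<bb>\<^sup>t\<close>, which is shown by induction on \<open>d\<close>, shifting dimensions in \<open>M\<close>.
  As \<open>Hom(R/\<bb>, M) = 0\<close>, the map \<open>M \<rightarrow> M\<^bsup>C\<^esup>, x \<mapsto> (r x)\<^sub>r\<close> is injective; let \<open>K\<close> be its cokernel. The long exact
  sequence gives \<open>Ext\<^sup>i(R/\<bb>, K) = 0\<close> for \<open>i < d - 1\<close>, so \<open>Ext\<^sup>i(R/J, K) = 0\<close> in the same range. Since
  \<open>C \<subseteq> J\<close> annihilates \<open>Ext(R/J, M)\<close>, the map \<open>Ext\<^bsup>i+1\<^esup>(R/J, M) \<rightarrow> Ext\<^bsup>i+1\<^esup>(R/J, M\<^bsup>C\<^esup>)\<close> is zero, hence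
  \<open>Ext\<^bsup>i+1\<^esup>(R/J, M)\<close> is a quotient of \<open>Ext\<^sup>i(R/J, K) = 0\<close>. To iterate this within one type, the
  modules are written as quotients of the module of functions \<open>R\<^sup>* \<rightarrow> M\<close> on words over \<open>R\<close>, which
  contains its own \<open>R\<close>-fold power as a direct factor.
\<close>

section \<open>Dimension shifting for complexes of free modules\<close>

declare free_mod_simps [simp del]

section \<open>Differences in modules and of linear maps\<close>

context module
begin

lemma minus_in_submodule:
  assumes "submodule H R M" "x \<in> H" "y \<in> H" shows "x \<ominus>\<^bsub>M\<^esub> y \<in> H"
  using submoduleE(3,5)[OF assms(1)] assms(2,3) by (simp add: a_minus_def)

lemma minus_zero_right: "x \<in> carrier M \<Longrightarrow> x \<ominus>\<^bsub>M\<^esub> \<zero>\<^bsub>M\<^esub> = x"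
  using smult_r_minus[of \<zero> "\<zero>\<^bsub>M\<^esub>"] by (simp add: a_minus_def)

lemma smult_minus_distr:
  assumes "r \<in> carrier R" "x \<in> carrier M" "y \<in> carrier M"
  shows "r \<odot>\<^bsub>M\<^esub> (x \<ominus>\<^bsub>M\<^esub> y) = r \<odot>\<^bsub>M\<^esub> x \<ominus>\<^bsub>M\<^esub> r \<odot>\<^bsub>M\<^esub> y"
  using assms by (simp add: a_minus_def smult_r_distr smult_r_minus)

lemma minus_add_minus:
  assumes "a \<in> carrier M" "b \<in> carrier M" "c \<in> carrier M" "d \<in> carrier M"
  shows "(a \<oplus>\<^bsub>M\<^esub> b) \<ominus>\<^bsub>M\<^esub> (c \<oplus>\<^bsub>M\<^esub> d) = (a \<ominus>\<^bsub>M\<^esub> c) \<oplus>\<^bsub>M\<^esub> (b \<ominus>\<^bsub>M\<^esub> d)"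
  using assms by (simp add: a_minus_def M.minus_add M.a_ac)

lemma minus_swap:
  assumes "a \<in> carrier M" "b \<in> carrier M" "c \<in> carrier M"
  shows "(a \<ominus>\<^bsub>M\<^esub> b) \<ominus>\<^bsub>M\<^esub> c = (a \<ominus>\<^bsub>M\<^esub> c) \<ominus>\<^bsub>M\<^esub> b"
  using assms by (simp add: a_minus_def M.a_ac)

lemma in_submodule_minus_iff:
  assumes H: "submodule H R M" and "x \<in> carrier M" "y \<in> carrier M" "x \<ominus>\<^bsub>M\<^esub> y \<in> H"
  shows "x \<in> H \<longleftrightarrow> y \<in> H"
proof
  have "x = (x \<ominus>\<^bsub>M\<^esub> y) \<oplus>\<^bsub>M\<^esub> y"
    using assms(2,3) by (simp add: a_minus_def M.a_assoc M.l_neg)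
  moreover have "y = x \<ominus>\<^bsub>M\<^esub> (x \<ominus>\<^bsub>M\<^esub> y)"
    using assms(2,3) by (simp add: a_minus_def M.minus_add M.minus_minus M.a_assoc[symmetric] M.r_neg)
  ultimately show "y \<in> H \<Longrightarrow> x \<in> H" "x \<in> H \<Longrightarrow> y \<in> H"
    using submoduleE(5)[OF H assms(4)] minus_in_submodule[OF H _ assms(4)] by metis+
qed

lemma lin_maps_minus:
  assumes "module R K" and f: "f \<in> lin_maps R K M" and g: "g \<in> lin_maps R K M"
  shows "(\<lambda>x\<in>carrier K. f x \<ominus>\<^bsub>M\<^esub> g x) \<in> lin_maps R K M"
proof -
  interpret K: module R K by fact
  show ?thesis
    unfolding lin_maps_def
    using lin_mapsD(2,3,4)[OF f] lin_mapsD(2,3,4)[OF g]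
    by (simp add: minus_add_minus smult_minus_distr PiE_def Pi_def)
qed

lemma lin_maps_app_minus:
  assumes "module R N" "f \<in> lin_maps R M N" "x \<in> carrier M" "y \<in> carrier M"
  shows "f (x \<ominus>\<^bsub>M\<^esub> y) = f x \<ominus>\<^bsub>N\<^esub> f y"
  using assms by (simp add: a_minus_def lin_mapsD(3)[OF assms(2)] lin_maps_a_inv)

end

section \<open>Complexes of free modules, exactness and homotopies\<close>

text \<open>
  Complexes are indexed so that the free module in degree \<open>Suc i\<close> is the \<open>i\<close>-th term of a resolution,
  and the one in degree \<open>0\<close> vanishes. \<open>exact_mod\<close> says that the \<open>i\<close>-th cohomology of the complex with
  coefficients in \<open>M/H\<close> is zero; as the terms are free, its cochains lift to maps into \<open>M\<close>.
\<close>

definition free_chain ::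
    "('r, 'q) ring_scheme \<Rightarrow> (nat \<Rightarrow> nat) \<Rightarrow> (nat \<Rightarrow> (nat \<Rightarrow> 'r) \<Rightarrow> (nat \<Rightarrow> 'r)) \<Rightarrow> bool" where
  "free_chain R k d \<longleftrightarrow> k 0 = 0 \<and>
     (\<forall>i. d i \<in> lin_maps R (free_mod R (k (Suc i))) (free_mod R (k i))) \<and>
     (\<forall>i. \<forall>x\<in>carrier (free_mod R (k (Suc (Suc i)))). d i (d (Suc i) x) = \<zero>\<^bsub>free_mod R (k i)\<^esub>)"

definition exact_mod ::
    "('r, 'q) ring_scheme \<Rightarrow> (nat \<Rightarrow> nat) \<Rightarrow> (nat \<Rightarrow> (nat \<Rightarrow> 'r) \<Rightarrow> (nat \<Rightarrow> 'r))
      \<Rightarrow> ('r, 'm, 'x) module_scheme \<Rightarrow> 'm set \<Rightarrow> nat \<Rightarrow> bool" where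
  "exact_mod R k d M H i \<longleftrightarrow> (\<forall>f\<in>lin_maps R (free_mod R (k (Suc i))) M.
     (\<forall>x\<in>carrier (free_mod R (k (Suc (Suc i)))). f (d (Suc i) x) \<in> H) \<longrightarrow>
     (\<exists>g\<in>lin_maps R (free_mod R (k i)) M.
        \<forall>x\<in>carrier (free_mod R (k (Suc i))). f x \<ominus>\<^bsub>M\<^esub> g (d i x) \<in> H))"

text \<open>A linear homotopy survives Hom into any coefficients, so such an \<open>r\<close>
  annihilates all cohomology of the complex. The relation starts in degree \<open>Suc i\<close>,
  since under \<open>free_chain\<close> the module in degree 0 vanishes.\<close>

definition null_homotopic ::
    "('r, 'q) ring_scheme \<Rightarrow> (nat \<Rightarrow> nat) \<Rightarrow> (nat \<Rightarrow> (nat \<Rightarrow> 'r) \<Rightarrow> (nat \<Rightarrow> 'r)) \<Rightarrow> 'r \<Rightarrow> bool" where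
  "null_homotopic R k d r \<longleftrightarrow>
     (\<exists>s. \<forall>i. s i \<in> lin_maps R (free_mod R (k i)) (free_mod R (k (Suc i))) \<and>
       (\<forall>x\<in>carrier (free_mod R (k (Suc i))). r \<odot>\<^bsub>free_mod R (k (Suc i))\<^esub> x =
          d (Suc i) (s (Suc i) x) \<oplus>\<^bsub>free_mod R (k (Suc i))\<^esub> s i (d i x)))"

lemma free_mod_0_carrier: "x \<in> carrier (free_mod R 0) \<Longrightarrow> x = \<zero>\<^bsub>free_mod R 0\<^esub>"
  by (auto simp: free_mod_simps)

section \<open>Modules that split off their own power, and cokernels inside them\<close>

text \<open>A module \<open>M\<close> with a family of projections exhibiting it as \<open>M\<^bsup>R\<^esup> \<times> K\<close> for some \<open>K\<close>.\<close>

locale self_power = module +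
  fixes p :: "'a \<Rightarrow> 'c \<Rightarrow> 'c" and glue :: "('a \<Rightarrow> 'c) \<Rightarrow> 'c"
  assumes p_closed [simp]: "x \<in> carrier M \<Longrightarrow> p r x \<in> carrier M"
    and p_add: "\<lbrakk>x \<in> carrier M; y \<in> carrier M\<rbrakk> \<Longrightarrow> p r (x \<oplus>\<^bsub>M\<^esub> y) = p r x \<oplus>\<^bsub>M\<^esub> p r y"
    and p_smult: "\<lbrakk>a \<in> carrier R; x \<in> carrier M\<rbrakk> \<Longrightarrow> p r (a \<odot>\<^bsub>M\<^esub> x) = a \<odot>\<^bsub>M\<^esub> p r x"
    and glue_closed [simp]: "(\<And>r. F r \<in> carrier M) \<Longrightarrow> glue F \<in> carrier M"
    and glue_add: "\<lbrakk>\<And>r. F r \<in> carrier M; \<And>r. G r \<in> carrier M\<rbrakk> \<Longrightarrow>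
      glue (\<lambda>r. F r \<oplus>\<^bsub>M\<^esub> G r) = glue F \<oplus>\<^bsub>M\<^esub> glue G"
    and glue_smult: "\<lbrakk>a \<in> carrier R; \<And>r. F r \<in> carrier M\<rbrakk> \<Longrightarrow>
      glue (\<lambda>r. a \<odot>\<^bsub>M\<^esub> F r) = a \<odot>\<^bsub>M\<^esub> glue F"
    and p_glue [simp]: "(\<And>r. F r \<in> carrier M) \<Longrightarrow> p r (glue F) = F r"
begin

lemma p_zero: "p r \<zero>\<^bsub>M\<^esub> = \<zero>\<^bsub>M\<^esub>"
  using p_smult[of \<zero> "\<zero>\<^bsub>M\<^esub>" r] by simp

lemma p_minus: "\<lbrakk>x \<in> carrier M; y \<in> carrier M\<rbrakk> \<Longrightarrow> p r (x \<ominus>\<^bsub>M\<^esub> y) = p r x \<ominus>\<^bsub>M\<^esub> p r y"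
  using p_smult[of "\<ominus> \<one>" y r] by (simp add: a_minus_def p_add smult_l_minus)

lemma lin_maps_glue:
  assumes "module R K" and F: "\<And>r. F r \<in> lin_maps R K M"
  shows "(\<lambda>x\<in>carrier K. glue (\<lambda>r. F r x)) \<in> lin_maps R K M"
proof -
  interpret K: module R K by fact
  show ?thesis
    unfolding lin_maps_def using lin_mapsD(2,3,4)[OF F]
    by (simp add: glue_add glue_smult PiE_def Pi_def)
qed

text \<open>The cokernel of \<open>M/H \<rightarrow> (M/H)\<^bsup>C\<^esup>, x \<mapsto> (r x)\<^sub>r\<close> is \<open>M\<close> modulo this submodule.\<close>

definition coker_mod :: "'a set \<Rightarrow> 'c set \<Rightarrow> 'c set" where
  "coker_mod C H = {x \<in> carrier M. \<exists>v\<in>carrier M. \<forall>r\<in>C. p r x \<ominus>\<^bsub>M\<^esub> r \<odot>\<^bsub>M\<^esub> v \<in> H}"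

lemma coker_mod_submodule:
  assumes H: "submodule H R M" and C: "C \<subseteq> carrier R"
  shows "submodule (coker_mod C H) R M"
proof -
  note HE = submoduleE[OF H] submodule_zero[OF H]
  have smult: "a \<odot>\<^bsub>M\<^esub> x \<in> coker_mod C H" if ax: "a \<in> carrier R" "x \<in> coker_mod C H" for a x
  proof -
    obtain v where v: "v \<in> carrier M" "\<And>r. r \<in> C \<Longrightarrow> p r x \<ominus>\<^bsub>M\<^esub> r \<odot>\<^bsub>M\<^esub> v \<in> H" and x: "x \<in> carrier M"
      using ax(2) unfolding coker_mod_def by blast
    have "p r (a \<odot>\<^bsub>M\<^esub> x) \<ominus>\<^bsub>M\<^esub> r \<odot>\<^bsub>M\<^esub> (a \<odot>\<^bsub>M\<^esub> v) = a \<odot>\<^bsub>M\<^esub> (p r x \<ominus>\<^bsub>M\<^esub> r \<odot>\<^bsub>M\<^esub> v)" if "r \<in> C" for r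
    proof -
      have r: "r \<in> carrier R" using C that by blast
      then have "r \<odot>\<^bsub>M\<^esub> (a \<odot>\<^bsub>M\<^esub> v) = a \<odot>\<^bsub>M\<^esub> (r \<odot>\<^bsub>M\<^esub> v)"
        using ax v(1) by (simp add: smult_assoc1[symmetric] R.m_comm)
      then show ?thesis using r ax x v(1) by (simp add: p_smult smult_minus_distr)
    qed
    then show ?thesis
      unfolding coker_mod_def using ax x v HE(4) by (auto intro!: bexI[of _ "a \<odot>\<^bsub>M\<^esub> v"])
  qed
  show ?thesis
  proof (rule submoduleI)
    show "coker_mod C H \<subseteq> carrier M" by (auto simp: coker_mod_def)
    have "p r \<zero>\<^bsub>M\<^esub> \<ominus>\<^bsub>M\<^esub> r \<odot>\<^bsub>M\<^esub> \<zero>\<^bsub>M\<^esub> \<in> H" if "r \<in> C" for r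
      using C that HE(3)[OF HE(7)] by (simp add: p_zero a_minus_def subset_iff)
    then show "\<zero>\<^bsub>M\<^esub> \<in> coker_mod C H"
      unfolding coker_mod_def by (intro CollectI conjI bexI[of _ "\<zero>\<^bsub>M\<^esub>"] ballI) simp_all
    show "\<ominus>\<^bsub>M\<^esub> x \<in> coker_mod C H" if "x \<in> coker_mod C H" for x
    proof -
      have "x \<in> carrier M" using that by (simp add: coker_mod_def)
      then have "\<ominus>\<^bsub>M\<^esub> x = (\<ominus> \<one>) \<odot>\<^bsub>M\<^esub> x" by (simp add: smult_l_minus)
      then show ?thesis using smult[OF _ that] by simp
    qed
    show "x \<oplus>\<^bsub>M\<^esub> y \<in> coker_mod C H" if xy: "x \<in> coker_mod C H" "y \<in> coker_mod C H" for x y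
    proof -
      obtain v w where v: "v \<in> carrier M" "\<And>r. r \<in> C \<Longrightarrow> p r x \<ominus>\<^bsub>M\<^esub> r \<odot>\<^bsub>M\<^esub> v \<in> H"
        and w: "w \<in> carrier M" "\<And>r. r \<in> C \<Longrightarrow> p r y \<ominus>\<^bsub>M\<^esub> r \<odot>\<^bsub>M\<^esub> w \<in> H"
        and x: "x \<in> carrier M" "y \<in> carrier M"
        using xy unfolding coker_mod_def by blast
      have "p r (x \<oplus>\<^bsub>M\<^esub> y) \<ominus>\<^bsub>M\<^esub> r \<odot>\<^bsub>M\<^esub> (v \<oplus>\<^bsub>M\<^esub> w) \<in> H" if "r \<in> C" for r
      proof -
        have r: "r \<in> carrier R" using C that by blast
        then have "p r (x \<oplus>\<^bsub>M\<^esub> y) \<ominus>\<^bsub>M\<^esub> r \<odot>\<^bsub>M\<^esub> (v \<oplus>\<^bsub>M\<^esub> w)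
            = (p r x \<ominus>\<^bsub>M\<^esub> r \<odot>\<^bsub>M\<^esub> v) \<oplus>\<^bsub>M\<^esub> (p r y \<ominus>\<^bsub>M\<^esub> r \<odot>\<^bsub>M\<^esub> w)"
          using v(1) w(1) x by (simp add: p_add smult_r_distr minus_add_minus)
        then show ?thesis using HE(5) v(2) w(2) that by simp
      qed
      then show ?thesis
        unfolding coker_mod_def using x v(1) w(1) by (auto intro!: bexI[of _ "v \<oplus>\<^bsub>M\<^esub> w"])
    qed
  qed (use smult in blast)
qed

text \<open>Freeness turns the pointwise witnesses in \<open>coker_mod\<close> into a linear one:
  \<open>g\<close> is prescribed on the basis, and for each \<open>r\<close> the elements at which
  the difference lies in \<open>H\<close> form a submodule containing that basis.\<close>

lemma lift_coker_mod:
  assumes H: "submodule H R M" and C: "C \<subseteq> carrier R"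
    and f: "f \<in> lin_maps R (free_mod R k) M"
    and fC: "\<And>x. x \<in> carrier (free_mod R k) \<Longrightarrow> f x \<in> coker_mod C H"
  shows "\<exists>g\<in>lin_maps R (free_mod R k) M. \<forall>x\<in>carrier (free_mod R k). \<forall>r\<in>C.
    p r (f x) \<ominus>\<^bsub>M\<^esub> r \<odot>\<^bsub>M\<^esub> g x \<in> H"
proof -
  let ?F = "free_mod R k" and ?e = "\<lambda>i. \<lambda>j\<in>{..<k}. if j = i then \<one> else \<zero>"
  interpret F: module R ?F by (rule free_mod_module) (rule R.is_cring)
  note HE = submoduleE[OF H] submodule_zero[OF H]
  have e: "?e i \<in> carrier ?F" for i by (auto simp: free_mod_simps)
  have "\<exists>v\<in>carrier M. \<forall>r\<in>C. p r (f (?e i)) \<ominus>\<^bsub>M\<^esub> r \<odot>\<^bsub>M\<^esub> v \<in> H" for i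
    using fC[OF e[of i]] unfolding coker_mod_def by blast
  then obtain v where v: "\<And>i. v i \<in> carrier M"
      "\<And>i r. r \<in> C \<Longrightarrow> p r (f (?e i)) \<ominus>\<^bsub>M\<^esub> r \<odot>\<^bsub>M\<^esub> v i \<in> H" by metis
  obtain g where g: "g \<in> lin_maps R ?F M" "\<And>i. i < k \<Longrightarrow> g (?e i) = v i"
    using free_mod_universal[of k v] v(1) by metis
  have "(\<lambda>x\<in>carrier ?F. p r (f x) \<ominus>\<^bsub>M\<^esub> r \<odot>\<^bsub>M\<^esub> g x) x \<in> H" if r: "r \<in> C" and x: "x \<in> carrier ?F" for r x
  proof -
    have rR: "r \<in> carrier R" using r C by blast
    have 1: "(\<lambda>x\<in>carrier ?F. p r (f x)) \<in> lin_maps R ?F M"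
      by (rule F.lin_maps_comp[OF f]) (simp_all add: p_add p_smult)
    have 2: "(\<lambda>x\<in>carrier ?F. r \<odot>\<^bsub>M\<^esub> g x) \<in> lin_maps R ?F M"
      by (rule F.lin_maps_comp[OF g(1)])
        (use rR in \<open>simp_all add: smult_r_distr smult_assoc1[symmetric] R.m_comm\<close>)
    let ?h = "\<lambda>x\<in>carrier ?F. p r (f x) \<ominus>\<^bsub>M\<^esub> r \<odot>\<^bsub>M\<^esub> g x"
    have h: "?h \<in> lin_maps R ?F M"
      using lin_maps_minus[OF F.module_axioms 1 2] by (simp cong: restrict_cong)
    have "submodule {x \<in> carrier ?F. ?h x \<in> H} R ?F"
      by (rule F.submoduleI)
        (use HE F.lin_maps_zero[OF module_axioms h] F.lin_maps_a_inv[OF module_axioms h]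
          lin_mapsD(3,4)[OF h] in \<open>auto simp del: restrict_apply\<close>)
    then have "{x \<in> carrier ?F. ?h x \<in> H} = carrier ?F"
      by (rule free_mod_basis_generates[OF R.is_cring]) (use e g(2) v(2)[OF r] in auto)
    then show ?thesis using x by blast
  qed
  then show ?thesis using g(1) by (intro bexI[of _ g]) auto
qed

section \<open>The long exact sequence of the cokernel\<close>

text \<open>With K the cokernel, this is the stretch H^i((M/H)^C) -> H^i(K) -> H^(i+1)(M/H) of the
  long exact sequence. The outer terms vanish by \<open>ex\<close>, the first one componentwise. The
  diagram chase is done on lifts to \<open>M\<close>.\<close>

lemma exact_mod_coker:
  assumes d: "free_chain R k d" and H: "submodule H R M" and C: "C \<subseteq> carrier R"
    and inj: "\<And>x. \<lbrakk>x \<in> carrier M; \<And>r. r \<in> C \<Longrightarrow> r \<odot>\<^bsub>M\<^esub> x \<in> H\<rbrakk> \<Longrightarrow> x \<in> H"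
    and ex: "exact_mod R k d M H i" "exact_mod R k d M H (Suc i)"
  shows "exact_mod R k d M (coker_mod C H) i"
  unfolding exact_mod_def
proof (intro ballI impI)
  let ?F = "\<lambda>i. free_mod R (k i)"
  have m: "module R (?F i)" for i by (rule free_mod_module) (rule R.is_cring)
  have dl: "d i \<in> lin_maps R (?F (Suc i)) (?F i)" for i using d by (simp add: free_chain_def)
  note dc [simp] = lin_mapsD(2)[OF dl]
  have dd: "d i (d (Suc i) x) = \<zero>\<^bsub>?F i\<^esub>" if "x \<in> carrier (?F (Suc (Suc i)))" for i x
    using d that by (simp add: free_chain_def)
  note HE = submoduleE[OF H] submodule_zero[OF H]
  fix f assume f: "f \<in> lin_maps R (?F (Suc i)) M"
    and fd: "\<forall>x\<in>carrier (?F (Suc (Suc i))). f (d (Suc i) x) \<in> coker_mod C H"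
  note fc [simp] = lin_mapsD(2)[OF f]
  let ?fd = "\<lambda>x\<in>carrier (?F (Suc (Suc i))). f (d (Suc i) x)"
  have "?fd \<in> lin_maps R (?F (Suc (Suc i))) M"
    by (rule module.lin_maps_comp[OF m dl]) (simp_all add: lin_mapsD[OF f])
  \<comment> \<open>\<open>g\<close> represents the connecting class of \<open>f\<close>: modulo
    \<open>H\<close>, the coboundary of \<open>f\<close> has components \<open>r\<close> times
    \<open>g\<close>.\<close>
  from lift_coker_mod[OF H C this] fd obtain g where g: "g \<in> lin_maps R (?F (Suc (Suc i))) M"
    and fg: "\<And>x r. \<lbrakk>x \<in> carrier (?F (Suc (Suc i))); r \<in> C\<rbrakk> \<Longrightarrow>
      p r (f (d (Suc i) x)) \<ominus>\<^bsub>M\<^esub> r \<odot>\<^bsub>M\<^esub> g x \<in> H"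
    by auto
  note gc [simp] = lin_mapsD(2)[OF g]
  \<comment> \<open>\<open>g\<close> is a cocycle modulo \<open>H\<close>: its coboundary is carried
    into \<open>H\<close> by every \<open>r\<close> in \<open>C\<close>, because d d = 0, and
    \<open>inj\<close> removes the factor.\<close>
  have "g (d (Suc (Suc i)) x) \<in> H" if x: "x \<in> carrier (?F (Suc (Suc (Suc i))))" for x
  proof (rule inj)
    fix r assume r: "r \<in> C"
    have "p r (f (d (Suc i) (d (Suc (Suc i)) x))) = \<zero>\<^bsub>M\<^esub>"
      using x by (simp add: dd module.lin_maps_zero[OF m module_axioms f] p_zero)
    then show "r \<odot>\<^bsub>M\<^esub> g (d (Suc (Suc i)) x) \<in> H"
      using fg[of "d (Suc (Suc i)) x", OF _ r] x r C HE(7)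
        in_submodule_minus_iff[OF H, of "\<zero>\<^bsub>M\<^esub>" "r \<odot>\<^bsub>M\<^esub> g (d (Suc (Suc i)) x)"]
      by (auto simp: subset_iff)
  qed (use x in simp)
  then obtain u where u: "u \<in> lin_maps R (?F (Suc i)) M"
    and gu: "\<And>x. x \<in> carrier (?F (Suc (Suc i))) \<Longrightarrow> g x \<ominus>\<^bsub>M\<^esub> u (d (Suc i) x) \<in> H"
    using ex(2) g unfolding exact_mod_def by metis
  note uc [simp] = lin_mapsD(2)[OF u]
  \<comment> \<open>After subtraction of \<open>r\<close> times \<open>u\<close>, each component of
    \<open>f\<close> is a cocycle modulo \<open>H\<close> and hence bounded by some
    \<open>v\<close>. Letting \<open>r\<close> range over the whole type, with the zero map as
    default outside \<open>C\<close>, yields a total family for \<open>glue\<close>.\<close>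
  have "\<exists>v. v \<in> lin_maps R (?F i) M \<and> (r \<in> C \<longrightarrow> (\<forall>x\<in>carrier (?F (Suc i)).
      (p r (f x) \<ominus>\<^bsub>M\<^esub> r \<odot>\<^bsub>M\<^esub> u x) \<ominus>\<^bsub>M\<^esub> v (d i x) \<in> H))" for r
  proof (cases "r \<in> C")
    case True
    then have r: "r \<in> carrier R" using C by blast
    have 1: "(\<lambda>x\<in>carrier (?F (Suc i)). p r (f x)) \<in> lin_maps R (?F (Suc i)) M"
      by (rule module.lin_maps_comp[OF m f]) (simp_all add: p_add p_smult)
    have 2: "(\<lambda>x\<in>carrier (?F (Suc i)). r \<odot>\<^bsub>M\<^esub> u x) \<in> lin_maps R (?F (Suc i)) M"
      by (rule module.lin_maps_comp[OF m u])
        (use r in \<open>simp_all add: smult_r_distr smult_assoc1[symmetric] R.m_comm\<close>)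
    let ?h = "\<lambda>x\<in>carrier (?F (Suc i)). p r (f x) \<ominus>\<^bsub>M\<^esub> r \<odot>\<^bsub>M\<^esub> u x"
    have h: "?h \<in> lin_maps R (?F (Suc i)) M"
      using lin_maps_minus[OF m 1 2] by (simp cong: restrict_cong)
    have "?h (d (Suc i) x) \<in> H" if x: "x \<in> carrier (?F (Suc (Suc i)))" for x
    proof -
      \<comment> \<open>Inserting \<open>r\<close> times \<open>g x\<close> splits the value into
        the error of \<open>g\<close> and \<open>r\<close> times the error of \<open>u\<close>, both
        in \<open>H\<close>.\<close>
      have "(p r (f (d (Suc i) x)) \<ominus>\<^bsub>M\<^esub> r \<odot>\<^bsub>M\<^esub> u (d (Suc i) x)) =
         (p r (f (d (Suc i) x)) \<ominus>\<^bsub>M\<^esub> r \<odot>\<^bsub>M\<^esub> g x) \<oplus>\<^bsub>M\<^esub> r \<odot>\<^bsub>M\<^esub> (g x \<ominus>\<^bsub>M\<^esub> u (d (Suc i) x))"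
        using r x by (simp add: smult_minus_distr)
          (simp add: a_minus_def M.a_assoc M.r_neg1)
      then show ?thesis using fg[OF x True] gu[OF x] x r HE(4,5) by simp
    qed
    then obtain v where "v \<in> lin_maps R (?F i) M"
      "\<forall>x\<in>carrier (?F (Suc i)). ?h x \<ominus>\<^bsub>M\<^esub> v (d i x) \<in> H"
      using ex(1) h unfolding exact_mod_def by blast
    then show ?thesis by auto
  next
    case False
    have "(\<lambda>x\<in>carrier (?F i). \<zero>\<^bsub>M\<^esub>) \<in> lin_maps R (?F i) M"
      using module.axioms(2)[OF m[of i]] module.smult_closed[OF m[of i]]
      by (auto simp: lin_maps_def abelian_group_def intro!: abelian_monoid.a_closed)
    then show ?thesis using False by blast
  qed
  then obtain v where v: "\<And>r. v r \<in> lin_maps R (?F i) M"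
    and fuv: "\<And>r x. \<lbrakk>r \<in> C; x \<in> carrier (?F (Suc i))\<rbrakk> \<Longrightarrow>
      (p r (f x) \<ominus>\<^bsub>M\<^esub> r \<odot>\<^bsub>M\<^esub> u x) \<ominus>\<^bsub>M\<^esub> v r (d i x) \<in> H"
    by metis
  note vc [simp] = lin_mapsD(2)[OF v]
  let ?v = "\<lambda>x\<in>carrier (?F i). glue (\<lambda>r. v r x)"
  have "f x \<ominus>\<^bsub>M\<^esub> ?v (d i x) \<in> coker_mod C H" if x: "x \<in> carrier (?F (Suc i))" for x
  proof -
    \<comment> \<open>The witness for membership in \<open>coker_mod\<close> is
      \<open>u x\<close>.\<close>
    have "p r (f x \<ominus>\<^bsub>M\<^esub> glue (\<lambda>r. v r (d i x))) \<ominus>\<^bsub>M\<^esub> r \<odot>\<^bsub>M\<^esub> u x \<in> H" if r: "r \<in> C" for r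
    proof -
      have "r \<in> carrier R" using r C by blast
      then have "p r (f x \<ominus>\<^bsub>M\<^esub> glue (\<lambda>r. v r (d i x))) \<ominus>\<^bsub>M\<^esub> r \<odot>\<^bsub>M\<^esub> u x
          = (p r (f x) \<ominus>\<^bsub>M\<^esub> r \<odot>\<^bsub>M\<^esub> u x) \<ominus>\<^bsub>M\<^esub> v r (d i x)"
        using x by (simp add: p_minus minus_swap)
      then show ?thesis using fuv[OF r x] by simp
    qed
    then show ?thesis unfolding coker_mod_def using x uc[OF x] by (intro CollectI conjI bexI[of _ "u x"]) simp_all
  qed
  then show "\<exists>v\<in>lin_maps R (?F i) M. \<forall>x\<in>carrier (?F (Suc i)). f x \<ominus>\<^bsub>M\<^esub> v (d i x) \<in> coker_mod C H"
    by (intro bexI[OF _ lin_maps_glue[OF m v]] ballI)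
qed

text \<open>Degree 0 is Hom: the homotopy shows that every \<open>r\<close> in \<open>C\<close>
  carries the values of a cocycle into \<open>H\<close>, so by \<open>inj\<close> they lie in
  \<open>H\<close> already, and the zero map serves as bounding cochain.\<close>

lemma exact_mod_0_null_homotopic:
  assumes d: "free_chain R k d" and H: "submodule H R M" and C: "C \<subseteq> carrier R"
    and inj: "\<And>x. \<lbrakk>x \<in> carrier M; \<And>r. r \<in> C \<Longrightarrow> r \<odot>\<^bsub>M\<^esub> x \<in> H\<rbrakk> \<Longrightarrow> x \<in> H"
    and null: "\<And>r. r \<in> C \<Longrightarrow> null_homotopic R k d r"
  shows "exact_mod R k d M H 0"
  unfolding exact_mod_def
proof (intro ballI impI)
  let ?F = "\<lambda>i. free_mod R (k i)"
  have m: "module R (?F i)" for i by (rule free_mod_module) (rule R.is_cring)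
  have dl: "d i \<in> lin_maps R (?F (Suc i)) (?F i)" for i using d by (simp add: free_chain_def)
  note dc [simp] = lin_mapsD(2)[OF dl]
  have k0: "k 0 = 0" using d by (simp add: free_chain_def)
  fix f assume f: "f \<in> lin_maps R (?F (Suc 0)) M"
    and fd: "\<forall>x\<in>carrier (?F (Suc (Suc 0))). f (d (Suc 0) x) \<in> H"
  have fH: "f x \<in> H" if x: "x \<in> carrier (?F (Suc 0))" for x
  proof (rule inj)
    fix r assume r: "r \<in> C"
    then obtain s where s: "\<And>i. s i \<in> lin_maps R (?F i) (?F (Suc i))"
      and rs: "r \<odot>\<^bsub>?F (Suc 0)\<^esub> x = d (Suc 0) (s (Suc 0) x) \<oplus>\<^bsub>?F (Suc 0)\<^esub> s 0 (d 0 x)"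
      using null[OF r] x unfolding null_homotopic_def by blast
    \<comment> \<open>The target of \<open>d 0\<close> is the zero module, so only one term of the
      homotopy relation remains.\<close>
    have "d 0 x = \<zero>\<^bsub>?F 0\<^esub>" using dc[OF x] free_mod_0_carrier unfolding k0 by blast
    then have "s 0 (d 0 x) = \<zero>\<^bsub>?F (Suc 0)\<^esub>" by (simp add: module.lin_maps_zero[OF m m s])
    then have "r \<odot>\<^bsub>?F (Suc 0)\<^esub> x = d (Suc 0) (s (Suc 0) x)"
      using rs x lin_mapsD(2)[OF s] abelian_monoid.r_zero[OF abelian_group.axioms(1)[OF module.axioms(2)[OF m]]]
      by simp
    then have "f (r \<odot>\<^bsub>?F (Suc 0)\<^esub> x) \<in> H" using fd lin_mapsD(2)[OF s] x by simp
    then show "r \<odot>\<^bsub>M\<^esub> f x \<in> H" using lin_mapsD(4)[OF f] r C x by auto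
  qed (use lin_mapsD(2)[OF f] x in simp)
  let ?z = "\<lambda>x\<in>carrier (?F 0). \<zero>\<^bsub>M\<^esub>"
  have "?z \<in> lin_maps R (?F 0) M"
    using module.axioms(2)[OF m[of 0]] module.smult_closed[OF m[of 0]]
    by (auto simp: lin_maps_def abelian_group_def intro!: abelian_monoid.a_closed)
  moreover have "f x \<ominus>\<^bsub>M\<^esub> ?z (d 0 x) \<in> H" if "x \<in> carrier (?F (Suc 0))" for x
    using fH that minus_in_submodule[OF H] submodule_zero[OF H] by simp
  ultimately show "\<exists>g\<in>lin_maps R (?F 0) M. \<forall>x\<in>carrier (?F (Suc 0)). f x \<ominus>\<^bsub>M\<^esub> g (d 0 x) \<in> H"
    by blast
qed

text \<open>Since each \<open>r\<close> in \<open>C\<close> annihilates the cohomology, the class of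
  a cocycle dies in the cohomology of (M/H)^C. It therefore comes from the cokernel through the
  connecting map, and there \<open>ex\<close> makes it zero.\<close>

lemma exact_mod_Suc_null_homotopic:
  assumes d: "free_chain R k d" and H: "submodule H R M" and C: "C \<subseteq> carrier R"
    and inj: "\<And>x. \<lbrakk>x \<in> carrier M; \<And>r. r \<in> C \<Longrightarrow> r \<odot>\<^bsub>M\<^esub> x \<in> H\<rbrakk> \<Longrightarrow> x \<in> H"
    and null: "\<And>r. r \<in> C \<Longrightarrow> null_homotopic R k d r"
    and ex: "exact_mod R k d M (coker_mod C H) i"
  shows "exact_mod R k d M H (Suc i)"
  unfolding exact_mod_def
proof (intro ballI impI)
  let ?F = "\<lambda>i. free_mod R (k i)" and ?j = "Suc i"
  have m: "module R (?F i)" for i by (rule free_mod_module) (rule R.is_cring)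
  have dl: "d i \<in> lin_maps R (?F (Suc i)) (?F i)" for i using d by (simp add: free_chain_def)
  note dc [simp] = lin_mapsD(2)[OF dl]
  have dd: "d i (d (Suc i) x) = \<zero>\<^bsub>?F i\<^esub>" if "x \<in> carrier (?F (Suc (Suc i)))" for i x
    using d that by (simp add: free_chain_def)
  note HE = submoduleE[OF H] submodule_zero[OF H]
  fix f assume f: "f \<in> lin_maps R (?F (Suc ?j)) M"
    and fd: "\<forall>x\<in>carrier (?F (Suc (Suc ?j))). f (d (Suc ?j) x) \<in> H"
  note fc [simp] = lin_mapsD(2)[OF f]
  \<comment> \<open>The homotopy relation writes \<open>r\<close> times \<open>f\<close> as a term
    through \<open>d\<close>, which lies in \<open>H\<close> because \<open>f\<close> is a cocycle,
    plus the coboundary of \<open>f\<close> composed with \<open>s\<close>. The homotopy depends on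
    \<open>r\<close>.\<close>
  have "\<exists>s. s \<in> lin_maps R (?F ?j) (?F (Suc ?j)) \<and> (r \<in> C \<longrightarrow> (\<forall>x\<in>carrier (?F (Suc ?j)).
      r \<odot>\<^bsub>M\<^esub> f x \<ominus>\<^bsub>M\<^esub> f (s (d ?j x)) \<in> H))" for r
  proof (cases "r \<in> C")
    case True
    then obtain s where s: "\<And>i. s i \<in> lin_maps R (?F i) (?F (Suc i))"
      and rs: "\<And>i x. x \<in> carrier (?F (Suc i)) \<Longrightarrow>
        r \<odot>\<^bsub>?F (Suc i)\<^esub> x = d (Suc i) (s (Suc i) x) \<oplus>\<^bsub>?F (Suc i)\<^esub> s i (d i x)"
      using null unfolding null_homotopic_def by metis
    note sc [simp] = lin_mapsD(2)[OF s]
    have "r \<odot>\<^bsub>M\<^esub> f x \<ominus>\<^bsub>M\<^esub> f (s ?j (d ?j x)) \<in> H" if x: "x \<in> carrier (?F (Suc ?j))" for x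
    proof -
      have "r \<odot>\<^bsub>M\<^esub> f x = f (d (Suc ?j) (s (Suc ?j) x)) \<oplus>\<^bsub>M\<^esub> f (s ?j (d ?j x))"
        using x True C rs[OF x] by (simp add: lin_mapsD(3,4)[OF f, symmetric] subset_iff)
      then have "r \<odot>\<^bsub>M\<^esub> f x \<ominus>\<^bsub>M\<^esub> f (s ?j (d ?j x)) = f (d (Suc ?j) (s (Suc ?j) x))"
        using x by (simp add: a_minus_def M.a_assoc M.r_neg)
      then show ?thesis using fd x by simp
    qed
    then show ?thesis using s by blast
  next
    case False
    have "(\<lambda>x\<in>carrier (?F ?j). \<zero>\<^bsub>?F (Suc ?j)\<^esub>) \<in> lin_maps R (?F ?j) (?F (Suc ?j))"
      using m by (auto simp: lin_maps_def module_def abelian_group_def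
          module.smult_closed[OF m] module.smult_r_null[OF m] abelian_monoid.a_closed abelian_monoid.zero_closed
          abelian_monoid.r_zero)
    then show ?thesis using False by blast
  qed
  then obtain s where s: "\<And>r. s r \<in> lin_maps R (?F ?j) (?F (Suc ?j))"
    and rs: "\<And>r x. \<lbrakk>r \<in> C; x \<in> carrier (?F (Suc ?j))\<rbrakk> \<Longrightarrow> r \<odot>\<^bsub>M\<^esub> f x \<ominus>\<^bsub>M\<^esub> f (s r (d ?j x)) \<in> H"
    by metis
  note sc [simp] = lin_mapsD(2)[OF s]
  let ?fs = "\<lambda>r. \<lambda>x\<in>carrier (?F ?j). f (s r x)"
  let ?g = "\<lambda>x\<in>carrier (?F ?j). glue (\<lambda>r. f (s r x))"
  have "?fs r \<in> lin_maps R (?F ?j) M" for r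
    by (rule module.lin_maps_comp[OF m s]) (simp_all add: lin_mapsD[OF f])
  then have g: "?g \<in> lin_maps R (?F ?j) M"
    using lin_maps_glue[OF m, of ?fs ?j] by (simp cong: restrict_cong)
  \<comment> \<open>Modulo \<open>H\<close> the components of the glued map at \<open>d ?j x\<close>
    are \<open>r\<close> times \<open>f x\<close>, so it is a cocycle with values in the cokernel,
    with witness \<open>f x\<close>.\<close>
  have "?g (d ?j x) \<in> coker_mod C H" if x: "x \<in> carrier (?F (Suc ?j))" for x
  proof -
    have "f (s r (d ?j x)) \<ominus>\<^bsub>M\<^esub> r \<odot>\<^bsub>M\<^esub> f x \<in> H" if "r \<in> C" for r
    proof -
      have "f (s r (d ?j x)) \<ominus>\<^bsub>M\<^esub> r \<odot>\<^bsub>M\<^esub> f x = \<ominus>\<^bsub>M\<^esub> (r \<odot>\<^bsub>M\<^esub> f x \<ominus>\<^bsub>M\<^esub> f (s r (d ?j x)))"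
        using x that C by (simp add: a_minus_def M.minus_add M.minus_minus M.a_comm subset_iff)
      then show ?thesis using rs[OF that x] HE(3) by simp
    qed
    then show ?thesis unfolding coker_mod_def using x fc[OF x] by (intro CollectI conjI bexI[of _ "f x"]) simp_all
  qed
  then obtain u where u: "u \<in> lin_maps R (?F i) M"
    and gu: "\<And>x. x \<in> carrier (?F ?j) \<Longrightarrow> ?g x \<ominus>\<^bsub>M\<^esub> u (d i x) \<in> coker_mod C H"
    using ex g unfolding exact_mod_def by metis
  let ?ud = "\<lambda>x\<in>carrier (?F ?j). u (d i x)"
  have "?ud \<in> lin_maps R (?F ?j) M"
    by (rule module.lin_maps_comp[OF m dl]) (simp_all add: lin_mapsD[OF u])
  from lin_maps_minus[OF m g this]
  have "(\<lambda>x\<in>carrier (?F ?j). ?g x \<ominus>\<^bsub>M\<^esub> u (d i x)) \<in> lin_maps R (?F ?j) M"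
    by (simp cong: restrict_cong)
  \<comment> \<open>The glued map minus its bounding coboundary takes values in the image of M/H.
    Its linear lift \<open>v\<close> is the cochain that bounds \<open>f\<close>.\<close>
  from lift_coker_mod[OF H C this] gu obtain v where v: "v \<in> lin_maps R (?F ?j) M"
    and gv: "\<And>x r. \<lbrakk>x \<in> carrier (?F ?j); r \<in> C\<rbrakk> \<Longrightarrow>
      p r (glue (\<lambda>r. f (s r x)) \<ominus>\<^bsub>M\<^esub> u (d i x)) \<ominus>\<^bsub>M\<^esub> r \<odot>\<^bsub>M\<^esub> v x \<in> H"
    by auto
  note vc [simp] = lin_mapsD(2)[OF v]
  have "f x \<ominus>\<^bsub>M\<^esub> v (d ?j x) \<in> H" if x: "x \<in> carrier (?F (Suc ?j))" for x
  proof (rule inj)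
    fix r assume r: "r \<in> C"
    then have rR: "r \<in> carrier R" using C by blast
    \<comment> \<open>On boundaries the \<open>u\<close> term disappears. Hence \<open>r\<close>
      times \<open>v\<close> agrees there modulo \<open>H\<close> with \<open>f\<close> composed
      with \<open>s r\<close>, which in turn agrees with \<open>r\<close> times \<open>f\<close>;
      \<open>inj\<close> cancels \<open>r\<close>.\<close>
    have "u (d i (d ?j x)) = \<zero>\<^bsub>M\<^esub>"
      using x by (simp add: dd module.lin_maps_zero[OF m module_axioms u])
    then have "f (s r (d ?j x)) \<ominus>\<^bsub>M\<^esub> r \<odot>\<^bsub>M\<^esub> v (d ?j x) \<in> H"
      using gv[of "d ?j x", OF _ r] x rR by (simp add: minus_zero_right)
    moreover have "r \<odot>\<^bsub>M\<^esub> (f x \<ominus>\<^bsub>M\<^esub> v (d ?j x)) = (r \<odot>\<^bsub>M\<^esub> f x \<ominus>\<^bsub>M\<^esub> f (s r (d ?j x)))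
        \<oplus>\<^bsub>M\<^esub> (f (s r (d ?j x)) \<ominus>\<^bsub>M\<^esub> r \<odot>\<^bsub>M\<^esub> v (d ?j x))"
      using x rR by (simp add: smult_minus_distr) (simp add: a_minus_def M.a_assoc M.r_neg1)
    ultimately show "r \<odot>\<^bsub>M\<^esub> (f x \<ominus>\<^bsub>M\<^esub> v (d ?j x)) \<in> H"
      using rs[OF r x] HE(5) by simp
  qed (use x in simp)
  then show "\<exists>g\<in>lin_maps R (?F ?j) M. \<forall>x\<in>carrier (?F (Suc ?j)). f x \<ominus>\<^bsub>M\<^esub> g (d ?j x) \<in> H"
    using v by blast
qed

text \<open>Dimension shifting: \<open>H\<close> is replaced by \<open>coker_mod C H\<close> inside
  the same \<open>M\<close>, which costs one degree of exactness for the first complex and gains one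
  for the second. The injectivity assumption ranges over all \<open>H\<close> because it is applied
  at every stage of the induction.\<close>

theorem exact_mod_transfer:
  assumes P: "free_chain R kP dP" and Q: "free_chain R kQ dQ" and C: "C \<subseteq> carrier R"
    and inj: "\<And>H x. \<lbrakk>submodule H R M; exact_mod R kP dP M H 0; x \<in> carrier M;
      \<And>r. r \<in> C \<Longrightarrow> r \<odot>\<^bsub>M\<^esub> x \<in> H\<rbrakk> \<Longrightarrow> x \<in> H"
    and null: "\<And>r. r \<in> C \<Longrightarrow> null_homotopic R kQ dQ r"
    and H: "submodule H R M" and ex: "\<And>i. i < n \<Longrightarrow> exact_mod R kP dP M H i"
    and i: "i < n"
  shows "exact_mod R kQ dQ M H i"
  using H ex i
proof (induction n arbitrary: H i)
  case (Suc n)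
  \<comment> \<open>The bound is \<open>Suc n\<close>, so exactness in degree 0 is
    available.\<close>
  have inj': "x \<in> H" if "x \<in> carrier M" "\<And>r. r \<in> C \<Longrightarrow> r \<odot>\<^bsub>M\<^esub> x \<in> H" for x
    using inj[OF Suc.prems(1) Suc.prems(2)[of 0]] that by blast
  show ?case
  proof (cases i)
    case 0
    show ?thesis
      unfolding 0 by (rule exact_mod_0_null_homotopic[OF Q Suc.prems(1) C]) (fact inj', fact null)
  next
    case (Suc j)
    \<comment> \<open>Exactness for the cokernel in degree \<open>i\<close> uses degrees
      \<open>i\<close> and \<open>Suc i\<close> for \<open>H\<close>, hence the drop from
      \<open>Suc n\<close> to \<open>n\<close>.\<close>
    have "exact_mod R kP dP M (coker_mod C H) i" if "i < n" for i
      by (rule exact_mod_coker[OF P Suc.prems(1) C])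
        (fact inj', use that in \<open>simp_all add: Suc.prems(2)\<close>)
    moreover have "j < n" using Suc Suc.prems(3) by simp
    ultimately have "exact_mod R kQ dQ M (coker_mod C H) j"
      by (intro Suc.IH[OF coker_mod_submodule[OF Suc.prems(1) C]])
    then show ?thesis
      unfolding Suc
      by (rule exact_mod_Suc_null_homotopic[OF Q Suc.prems(1) C inj' null, rotated -1])
  qed
qed simp

end

section \<open>Free resolutions of cyclic modules\<close>

text \<open>The comparison argument for resolutions: the homotopy is built degree by degree, each
  component being a lift from a free module along the next boundary map.\<close>

lemma chain_null_homotopic:
  fixes R (structure)
  assumes R: "cring R" and d: "free_chain R k d" and r: "r \<in> carrier R"
    and ex: "\<And>i x. \<lbrakk>x \<in> carrier (free_mod R (k (Suc (Suc i)))); d (Suc i) x = \<zero>\<^bsub>free_mod R (k (Suc i))\<^esub>\<rbrakk>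
      \<Longrightarrow> x \<in> d (Suc (Suc i)) ` carrier (free_mod R (k (Suc (Suc (Suc i)))))"
    and r0: "\<And>x. x \<in> carrier (free_mod R (k (Suc 0))) \<Longrightarrow>
      r \<odot>\<^bsub>free_mod R (k (Suc 0))\<^esub> x \<in> d (Suc 0) ` carrier (free_mod R (k (Suc (Suc 0))))"
  shows "null_homotopic R k d r"
proof -
  interpret cring R by fact
  let ?F = "\<lambda>i. free_mod R (k i)"
  interpret F: module R "?F i" for i by (rule free_mod_module[OF R])
  have dl: "d i \<in> lin_maps R (?F (Suc i)) (?F i)" for i using d by (simp add: free_chain_def)
  note dc [simp] = lin_mapsD(2)[OF dl]
  have dd: "d i (d (Suc i) x) = \<zero>\<^bsub>?F i\<^esub>" if "x \<in> carrier (?F (Suc (Suc i)))" for i x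
    using d that by (simp add: free_chain_def)
  \<comment> \<open>The invariant \<open>?P\<close> places the remaining error in the image of the
    next boundary map, which is what the lift to the next component needs.\<close>
  let ?P = "\<lambda>i s. s \<in> lin_maps R (?F i) (?F (Suc i)) \<and> (\<forall>x\<in>carrier (?F (Suc i)).
    r \<odot>\<^bsub>?F (Suc i)\<^esub> x \<ominus>\<^bsub>?F (Suc i)\<^esub> s (d i x) \<in> d (Suc i) ` carrier (?F (Suc (Suc i))))"
  let ?Q = "\<lambda>i s s'. \<forall>x\<in>carrier (?F (Suc i)).
    r \<odot>\<^bsub>?F (Suc i)\<^esub> x = d (Suc i) (s' x) \<oplus>\<^bsub>?F (Suc i)\<^esub> s (d i x)"
  have "\<exists>s. \<forall>i. ?P i (s i) \<and> ?Q i (s i) (s (Suc i))"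
  proof (rule dependent_nat_choice)
    \<comment> \<open>The homotopy starts with the zero map, and \<open>r0\<close> is then the
      invariant.\<close>
    have "(\<lambda>x\<in>carrier (?F 0). \<zero>\<^bsub>?F (Suc 0)\<^esub>) \<in> lin_maps R (?F 0) (?F (Suc 0))"
      by (auto simp: lin_maps_def)
    then show "\<exists>s. ?P 0 s"
      using r r0 by (intro exI[of _ "\<lambda>x\<in>carrier (?F 0). \<zero>\<^bsub>?F (Suc 0)\<^esub>"]) (simp add: F.minus_zero_right)
  next
    fix s i assume s: "?P i s"
    then have sl: "s \<in> lin_maps R (?F i) (?F (Suc i))" by blast
    note sc [simp] = lin_mapsD(2)[OF sl]
    let ?f = "\<lambda>x\<in>carrier (?F (Suc i)). r \<odot>\<^bsub>?F (Suc i)\<^esub> x \<ominus>\<^bsub>?F (Suc i)\<^esub> s (d i x)"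
    have 1: "(\<lambda>x\<in>carrier (?F (Suc i)). r \<odot>\<^bsub>?F (Suc i)\<^esub> x) \<in> lin_maps R (?F (Suc i)) (?F (Suc i))"
      using r by (auto simp: lin_maps_def F.smult_r_distr F.smult_assoc1[symmetric] m_comm)
    have 2: "(\<lambda>x\<in>carrier (?F (Suc i)). s (d i x)) \<in> lin_maps R (?F (Suc i)) (?F (Suc i))"
      by (rule F.lin_maps_comp[OF dl]) (simp_all add: lin_mapsD[OF sl])
    have f: "?f \<in> lin_maps R (?F (Suc i)) (?F (Suc i))"
      using F.lin_maps_minus[OF F.module_axioms 1 2] by (simp cong: restrict_cong)
    have "?f ` carrier (?F (Suc i)) \<subseteq> d (Suc i) ` carrier (?F (Suc (Suc i)))"
      using s by auto
    then obtain s' where s': "s' \<in> lin_maps R (?F (Suc i)) (?F (Suc (Suc i)))"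
      and ds': "\<And>x. x \<in> carrier (?F (Suc i)) \<Longrightarrow>
        d (Suc i) (s' x) = r \<odot>\<^bsub>?F (Suc i)\<^esub> x \<ominus>\<^bsub>?F (Suc i)\<^esub> s (d i x)"
      using free_mod_lift[OF R F.module_axioms F.module_axioms f dl] by auto
    note s'c [simp] = lin_mapsD(2)[OF s']
    let ?i = "Suc (Suc i)"
    \<comment> \<open>The new error is a cycle: applying \<open>d (Suc i)\<close> leaves
      \<open>s\<close> on a double boundary, which is zero. Exactness then makes it a
      boundary.\<close>
    have "r \<odot>\<^bsub>?F ?i\<^esub> x \<ominus>\<^bsub>?F ?i\<^esub> s' (d (Suc i) x) \<in> d ?i ` carrier (?F (Suc ?i))"
      if x: "x \<in> carrier (?F ?i)" for x
    proof (rule ex)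
      have "s (d i (d (Suc i) x)) = \<zero>\<^bsub>?F (Suc i)\<^esub>"
        using x by (simp add: dd F.lin_maps_zero[OF F.module_axioms sl])
      then show "d (Suc i) (r \<odot>\<^bsub>?F ?i\<^esub> x \<ominus>\<^bsub>?F ?i\<^esub> s' (d (Suc i) x)) = \<zero>\<^bsub>?F (Suc i)\<^esub>"
        using x r by (simp add: F.lin_maps_app_minus[OF F.module_axioms dl] lin_mapsD(4)[OF dl] ds'
            F.minus_zero_right) (simp add: a_minus_def F.M.r_neg)
    qed (use x r in simp)
    moreover have "r \<odot>\<^bsub>?F (Suc i)\<^esub> x = d (Suc i) (s' x) \<oplus>\<^bsub>?F (Suc i)\<^esub> s (d i x)"
      if x: "x \<in> carrier (?F (Suc i))" for x
      using x r by (simp add: ds') (simp add: a_minus_def F.M.a_assoc F.M.l_neg)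
    ultimately show "\<exists>s'. ?P (Suc i) s' \<and> ?Q i s s'" using s' by blast
  qed
  then obtain s where "\<forall>i. ?P i (s i) \<and> ?Q i (s i) (s (Suc i))" by (rule exE)
  then show ?thesis unfolding null_homotopic_def by blast
qed

section \<open>Resolutions as shifted complexes\<close>

definition res_rk :: "('r, 'n) free_complex \<Rightarrow> nat \<Rightarrow> nat" where
  "res_rk F = case_nat 0 (rk F)"

definition res_bd :: "('r, 'q) ring_scheme \<Rightarrow> ('r, 'n) free_complex
    \<Rightarrow> nat \<Rightarrow> (nat \<Rightarrow> 'r) \<Rightarrow> (nat \<Rightarrow> 'r)" where
  "res_bd R F = case_nat (\<lambda>x\<in>carrier (free_mod R (rk F 0)). \<zero>\<^bsub>free_mod R 0\<^esub>) (bd F)"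

lemma res_simps [simp]:
  "res_rk F 0 = 0" "res_rk F (Suc i) = rk F i" "res_bd R F (Suc i) = bd F i"
  "res_bd R F 0 = (\<lambda>x\<in>carrier (free_mod R (rk F 0)). \<zero>\<^bsub>free_mod R 0\<^esub>)"
  by (simp_all add: res_rk_def res_bd_def)

lemma free_resolution_bd_bd:
  assumes "free_resolution R N F" "x \<in> carrier (free_mod R (rk F (Suc (Suc i))))"
  shows "bd F i (bd F (Suc i) x) = \<zero>\<^bsub>free_mod R (rk F i)\<^esub>"
  using assms unfolding free_resolution_def by blast

lemma free_chain_res:
  assumes "cring R" "free_resolution R N F"
  shows "free_chain R (res_rk F) (res_bd R F)"
proof -
  interpret F0: module R "free_mod R 0" by (rule free_mod_module) fact
  interpret F: module R "free_mod R (rk F 0)" by (rule free_mod_module) fact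
  have bd: "bd F i \<in> lin_maps R (free_mod R (rk F (Suc i))) (free_mod R (rk F i))" for i
    using assms(2) by (simp add: free_resolution_def)
  show ?thesis
    unfolding free_chain_def
  proof (intro conjI allI ballI)
    show "res_bd R F i \<in> lin_maps R (free_mod R (res_rk F (Suc i))) (free_mod R (res_rk F i))" for i
      by (cases i) (auto simp: bd lin_maps_def[of _ _ "free_mod R 0"])
    show "res_bd R F i (res_bd R F (Suc i) x) = \<zero>\<^bsub>free_mod R (res_rk F i)\<^esub>"
      if "x \<in> carrier (free_mod R (res_rk F (Suc (Suc i))))" for i x
      using that free_resolution_bd_bd[OF assms(2)] lin_mapsD(2)[OF bd] by (cases i) auto
  qed simp
qed

lemma (in cring) quot_ring_facts:
  assumes I: "ideal I R"
  shows "carrier (quot_mod (ring_mod R) I) = {I +> x | x. x \<in> carrier R}"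
    and "\<zero>\<^bsub>quot_mod (ring_mod R) I\<^esub> = I"
    and "\<lbrakk>r \<in> carrier R; x \<in> carrier R\<rbrakk> \<Longrightarrow> r \<odot>\<^bsub>quot_mod (ring_mod R) I\<^esub> (I +> x) = I +> (r \<otimes> x)"
    and "\<lbrakk>x \<in> carrier R; y \<in> carrier R\<rbrakk> \<Longrightarrow>
      (I +> x) \<oplus>\<^bsub>quot_mod (ring_mod R) I\<^esub> (I +> y) = I +> (x \<oplus> y)"
proof -
  interpret ideal I R by fact
  have eq: "(+>\<^bsub>ring_mod R\<^esub>) = (+>)" "set_add (ring_mod R) = set_add R"
    by (simp_all add: a_r_coset_def r_coset_def ring_mod_def set_add_def set_mult_def fun_eq_iff)
  show "carrier (quot_mod (ring_mod R) I) = {I +> x | x. x \<in> carrier R}"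
    "\<zero>\<^bsub>quot_mod (ring_mod R) I\<^esub> = I"
    by (auto simp: quot_mod_def A_RCOSETS_def' eq)
  show "\<lbrakk>r \<in> carrier R; x \<in> carrier R\<rbrakk> \<Longrightarrow> r \<odot>\<^bsub>quot_mod (ring_mod R) I\<^esub> (I +> x) = I +> (r \<otimes> x)"
    using module.quot_mod_smult[OF ring_mod_module ideal_submodule[OF I], of r x] by (simp add: eq)
  show "\<lbrakk>x \<in> carrier R; y \<in> carrier R\<rbrakk> \<Longrightarrow>
      (I +> x) \<oplus>\<^bsub>quot_mod (ring_mod R) I\<^esub> (I +> y) = I +> (x \<oplus> y)"
    using a_rcos_sum by (simp add: quot_mod_def eq)
qed

lemma (in ideal) a_rcos_zero_iff: "x \<in> carrier R \<Longrightarrow> I +> x = I \<longleftrightarrow> x \<in> I"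
  using a_rcos_const a_rcos_self by metis

text \<open>Multiplication by \<open>r\<close> is zero on R/I, so it maps the term of rank
  \<open>rk F 0\<close> into the kernel of the augmentation, which is the image of the first
  boundary map.\<close>

lemma res_null_homotopic:
  fixes R (structure)
  assumes R: "cring R" and I: "ideal I R"
    and F: "free_resolution R (quot_mod (ring_mod R) I) F" and r: "r \<in> I"
  shows "null_homotopic R (res_rk F) (res_bd R F) r"
proof (rule chain_null_homotopic[OF R free_chain_res[OF R F]])
  interpret cring R by fact
  interpret I: ideal I R by fact
  interpret F: module R "free_mod R (rk F 0)" by (rule free_mod_module[OF R])
  show rR: "r \<in> carrier R" using r by simp
  have aug: "aug F \<in> lin_maps R (free_mod R (rk F 0)) (quot_mod (ring_mod R) I)"
    using F by (simp add: free_resolution_def)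
  fix x assume "x \<in> carrier (free_mod R (res_rk F (Suc 0)))"
  then have x: "x \<in> carrier (free_mod R (rk F 0))" by simp
  then obtain y where y: "aug F x = I +> y" "y \<in> carrier R"
    using lin_mapsD(2)[OF aug] quot_ring_facts(1)[OF I] by blast
  have "aug F (r \<odot>\<^bsub>free_mod R (rk F 0)\<^esub> x) = I +> (r \<otimes> y)"
    using x y rR by (simp add: lin_mapsD(4)[OF aug] quot_ring_facts(3)[OF I])
  also have "\<dots> = I" using I.I_r_closed[OF r y(2)] I.a_rcos_zero_iff by simp
  finally have "r \<odot>\<^bsub>free_mod R (rk F 0)\<^esub> x \<in>
      {x \<in> carrier (free_mod R (rk F 0)). aug F x = \<zero>\<^bsub>quot_mod (ring_mod R) I\<^esub>}"
    using x rR quot_ring_facts(2)[OF I] by simp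
  then show "r \<odot>\<^bsub>free_mod R (res_rk F (Suc 0))\<^esub> x \<in>
      res_bd R F (Suc 0) ` carrier (free_mod R (res_rk F (Suc (Suc 0))))"
    using F unfolding free_resolution_def by simp
next
  show "x \<in> res_bd R F (Suc (Suc i)) ` carrier (free_mod R (res_rk F (Suc (Suc (Suc i)))))"
    if "x \<in> carrier (free_mod R (res_rk F (Suc (Suc i))))"
      "res_bd R F (Suc i) x = \<zero>\<^bsub>free_mod R (res_rk F (Suc i))\<^esub>" for i x
    using F that unfolding free_resolution_def by simp
qed

text \<open>An element that \<open>I\<close> carries into \<open>H\<close> defines a homomorphism
  R/I -> M/H sending 1 to it. This is a cocycle in degree 0, where all coboundaries vanish, so the
  homomorphism is zero.\<close>

lemma (in module) exact_mod_0_torsion_free: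
  assumes I: "ideal I R" and F: "free_resolution R (quot_mod (ring_mod R) I) F"
    and H: "submodule H R M" and ex: "exact_mod R (res_rk F) (res_bd R F) M H 0"
    and x: "x \<in> carrier M" "\<And>r. r \<in> I \<Longrightarrow> r \<odot>\<^bsub>M\<^esub> x \<in> H"
  shows "x \<in> H"
proof -
  let ?Q = "quot_mod (ring_mod R) I" and ?F = "\<lambda>i. free_mod R (rk F i)"
  interpret I: ideal I R by fact
  interpret RM: module R "ring_mod R" by (rule R.ring_mod_module)
  interpret Q: module R ?Q by (rule RM.quot_mod_module[OF R.ideal_submodule[OF I]])
  interpret F: module R "?F i" for i by (rule free_mod_module[OF R.is_cring])
  interpret F0: module R "free_mod R 0" by (rule free_mod_module[OF R.is_cring])
  note Qf = R.quot_ring_facts[OF I]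
  have aug: "aug F \<in> lin_maps R (?F 0) ?Q" and onto: "aug F ` carrier (?F 0) = carrier ?Q"
    and bd: "bd F 0 ` carrier (?F 1) = {x \<in> carrier (?F 0). aug F x = \<zero>\<^bsub>?Q\<^esub>}"
    using F by (simp_all add: free_resolution_def)
  let ?q = "\<lambda>y\<in>carrier (ring_mod R). I +> y"
  have q: "?q \<in> lin_maps R (ring_mod R) ?Q"
    by (auto simp: lin_maps_def Qf)
  have "aug F ` carrier (?F 0) \<subseteq> ?q ` carrier (ring_mod R)"
    unfolding onto Qf(1) by auto
  \<comment> \<open>\<open>\<pi>\<close> lifts the augmentation through R -> R/I and thus maps
    boundaries into \<open>I\<close>.\<close>
  then obtain \<pi> where \<pi>: "\<pi> \<in> lin_maps R (?F 0) (ring_mod R)"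
    and q\<pi>: "\<And>y. y \<in> carrier (?F 0) \<Longrightarrow> I +> \<pi> y = aug F y"
    using free_mod_lift[OF R.is_cring RM.module_axioms Q.module_axioms aug q] lin_mapsD(2)
    by (metis restrict_apply')
  have \<pi>c: "\<pi> y \<in> carrier R" if "y \<in> carrier (?F 0)" for y using lin_mapsD(2)[OF \<pi> that] by simp
  let ?f = "\<lambda>y\<in>carrier (?F 0). \<pi> y \<odot>\<^bsub>M\<^esub> x"
  have f: "?f \<in> lin_maps R (?F 0) M"
    using x(1) lin_mapsD(3,4)[OF \<pi>]
    by (auto simp: lin_maps_def[of _ _ M] \<pi>c smult_l_distr smult_assoc1)
  have "?f (bd F 0 y) \<in> H" if "y \<in> carrier (?F 1)" for y
  proof -
    have y: "bd F 0 y \<in> carrier (?F 0)" "aug F (bd F 0 y) = I" using bd that Qf(2) by auto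
    then have "\<pi> (bd F 0 y) \<in> I" using q\<pi>[OF y(1)] I.a_rcos_zero_iff[OF \<pi>c] by simp
    then show ?thesis using x(2) y(1) by simp
  qed
  then obtain g where g: "g \<in> lin_maps R (free_mod R 0) M"
    "\<forall>y\<in>carrier (?F 0). ?f y \<ominus>\<^bsub>M\<^esub> g (res_bd R F 0 y) \<in> H"
    using ex f unfolding exact_mod_def by auto
  have fH: "\<pi> y \<odot>\<^bsub>M\<^esub> x \<in> H" if y: "y \<in> carrier (?F 0)" for y
    using g(2) y x(1) by (auto simp: F0.lin_maps_zero[OF module_axioms g(1)] \<pi>c minus_zero_right)
  \<comment> \<open>A preimage \<open>y\<close> of the class of 1 gives 1 = a +
    \<open>\<pi> y\<close> with \<open>a\<close> in \<open>I\<close>; both parts carry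
    \<open>x\<close> into \<open>H\<close>.\<close>
  have "I +> \<one> \<in> aug F ` carrier (?F 0)" unfolding onto Qf(1) by blast
  then obtain y where y: "y \<in> carrier (?F 0)" "aug F y = I +> \<one>" by auto
  then have "\<one> \<in> I +> \<pi> y" using q\<pi>[OF y(1)] I.a_rcos_self[of \<one>] by simp
  then obtain a where a: "a \<in> I" "\<one> = a \<oplus> \<pi> y" by (auto simp: a_r_coset_def')
  have "x = a \<odot>\<^bsub>M\<^esub> x \<oplus>\<^bsub>M\<^esub> \<pi> y \<odot>\<^bsub>M\<^esub> x"
    using a smult_one[OF x(1)] smult_l_distr[of a "\<pi> y" x] \<pi>c[OF y(1)] x(1) by simp
  then show ?thesis using submoduleE(5)[OF H] x(2)[OF a(1)] fH[OF y(1)] by metis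
qed

section \<open>Powers of ideals\<close>

context cring
begin

lemma ideals_set_simps [simp]:
  "\<one>\<^bsub>ideals_set R\<^esub> = carrier R" "I \<otimes>\<^bsub>ideals_set R\<^esub> J = I \<cdot> J"
  by (simp_all add: ideals_set_def)

lemma ideal_pow_ideal: "ideal I R \<Longrightarrow> ideal (I [^]\<^bsub>ideals_set R\<^esub> (t::nat)) R"
  by (induction t) (simp_all add: oneideal ideal_prod_is_ideal)

lemma ideal_pow_antimono:
  assumes I: "ideal I R" and "s \<le> t"
  shows "I [^]\<^bsub>ideals_set R\<^esub> (t::nat) \<subseteq> I [^]\<^bsub>ideals_set R\<^esub> s"
  using \<open>s \<le> t\<close>
proof (induction t rule: dec_induct)
  case (step t)
  have "I [^]\<^bsub>ideals_set R\<^esub> Suc t \<subseteq> I [^]\<^bsub>ideals_set R\<^esub> t"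
    using ideal_prod_inter[OF ideal_pow_ideal[OF I] I] by (simp add: le_infE)
  then show ?case using step.IH by blast
qed simp

lemma ideal_prod_mono:
  assumes "I \<subseteq> I'" "J \<subseteq> J'" shows "I \<cdot> J \<subseteq> I' \<cdot> J'"
proof
  fix x assume "x \<in> I \<cdot> J"
  then show "x \<in> I' \<cdot> J'"
    by induction (use assms in \<open>auto intro: ideal_prod.intros\<close>)
qed

lemma ideal_pow_mono: "I \<subseteq> J \<Longrightarrow> I [^]\<^bsub>ideals_set R\<^esub> (t::nat) \<subseteq> J [^]\<^bsub>ideals_set R\<^esub> t"
  by (induction t) (simp_all add: ideal_prod_mono)

end

text \<open>One factor is peeled off at a time: for \<open>a\<close> in \<open>I\<close>, the
  element \<open>a\<close> times \<open>x\<close> satisfies the hypothesis for the power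
  \<open>t\<close>. The zeroth power is the whole ring and contains 1.\<close>

lemma (in module) pow_torsion_free:
  assumes I: "ideal I R"
    and tf: "\<And>x. \<lbrakk>x \<in> carrier M; \<And>r. r \<in> I \<Longrightarrow> r \<odot>\<^bsub>M\<^esub> x \<in> H\<rbrakk> \<Longrightarrow> x \<in> H"
    and x: "x \<in> carrier M" "\<And>r. r \<in> I [^]\<^bsub>ideals_set R\<^esub> (t::nat) \<Longrightarrow> r \<odot>\<^bsub>M\<^esub> x \<in> H"
  shows "x \<in> H"
  using x
proof (induction t arbitrary: x)
  case 0
  then show ?case using 0(2)[of \<one>] by simp
next
  case (Suc t)
  interpret I: ideal I R by fact
  interpret It: ideal "I [^]\<^bsub>ideals_set R\<^esub> t" R by (rule R.ideal_pow_ideal[OF I])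
  show ?case
  proof (rule tf[OF Suc.prems(1)])
    fix a assume a: "a \<in> I"
    show "a \<odot>\<^bsub>M\<^esub> x \<in> H"
    proof (rule Suc.IH)
      fix r assume r: "r \<in> I [^]\<^bsub>ideals_set R\<^esub> t"
      then have "r \<otimes> a \<in> I [^]\<^bsub>ideals_set R\<^esub> (Suc t)"
        using a by (simp add: ideal_prod.prod)
      then show "r \<odot>\<^bsub>M\<^esub> (a \<odot>\<^bsub>M\<^esub> x) \<in> H"
        using Suc.prems r a by (simp add: smult_assoc1[symmetric])
    qed (use a Suc.prems in simp)
  qed
qed

section \<open>The module of functions on words\<close>

text \<open>All functions on the index type are taken, so that shifting words involves no domain
  conditions.\<close>

definition fun_mod :: "('r, 'm, 'x) module_scheme \<Rightarrow> ('r, 'l \<Rightarrow> 'm) module" where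
  "fun_mod M = \<lparr>carrier = {f. \<forall>l. f l \<in> carrier M}, monoid.mult = undefined, one = undefined,
     zero = (\<lambda>_. \<zero>\<^bsub>M\<^esub>), add = (\<lambda>f g l. f l \<oplus>\<^bsub>M\<^esub> g l), smult = (\<lambda>r f l. r \<odot>\<^bsub>M\<^esub> f l)\<rparr>"

lemma fun_mod_simps [simp]:
  "f \<in> carrier (fun_mod M) \<longleftrightarrow> (\<forall>l. f l \<in> carrier M)"
  "\<zero>\<^bsub>fun_mod M\<^esub> = (\<lambda>_. \<zero>\<^bsub>M\<^esub>)"
  "f \<oplus>\<^bsub>fun_mod M\<^esub> g = (\<lambda>l. f l \<oplus>\<^bsub>M\<^esub> g l)"
  "r \<odot>\<^bsub>fun_mod M\<^esub> f = (\<lambda>l. r \<odot>\<^bsub>M\<^esub> f l)"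
  by (simp_all add: fun_mod_def)

context module
begin

lemma fun_mod_module: "module R (fun_mod M)"
proof (rule moduleI)
  show "abelian_group (fun_mod M)"
  proof (rule abelian_groupI)
    fix f assume "f \<in> carrier (fun_mod M)"
    then show "\<exists>g\<in>carrier (fun_mod M). g \<oplus>\<^bsub>fun_mod M\<^esub> f = \<zero>\<^bsub>fun_mod M\<^esub>"
      by (intro bexI[of _ "\<lambda>l. \<ominus>\<^bsub>M\<^esub> f l"]) (auto simp: M.l_neg)
  qed (auto simp: M.a_ac)
qed (auto simp: R.is_cring smult_l_distr smult_r_distr smult_assoc1)

lemma fun_mod_minus:
  assumes "f \<in> carrier (fun_mod M)" "g \<in> carrier (fun_mod M)"
  shows "(f \<ominus>\<^bsub>fun_mod M\<^esub> g) l = f l \<ominus>\<^bsub>M\<^esub> g l"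
proof -
  interpret W: module R "fun_mod M" by (rule fun_mod_module)
  have "\<ominus>\<^bsub>fun_mod M\<^esub> g = (\<ominus> \<one>) \<odot>\<^bsub>fun_mod M\<^esub> g" using assms(2) W.smult_l_minus[of \<one> g] by simp
  then show ?thesis using assms by (simp add: a_minus_def smult_l_minus)
qed

text \<open>A word is empty or has a first letter, so a function on words is its value at the empty
  word together with one function on words per letter. Glueing puts zero at the empty word.\<close>

lemma fun_mod_self_power:
  "self_power R (fun_mod M) (\<lambda>r f l. f (r # l))
     (\<lambda>F l. case l of [] \<Rightarrow> \<zero>\<^bsub>M\<^esub> | r # l' \<Rightarrow> F r l')"
  by (intro self_power.intro self_power_axioms.intro fun_mod_module)
    (auto simp: fun_eq_iff split: list.split)

lemma eval_kernel_submodule: "submodule {f \<in> carrier (fun_mod M). f l = \<zero>\<^bsub>M\<^esub>} R (fun_mod M)"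
proof -
  interpret W: module R "fun_mod M" by (rule fun_mod_module)
  show ?thesis
  proof (rule W.submoduleI)
    fix f assume f: "f \<in> {f \<in> carrier (fun_mod M). f l = \<zero>\<^bsub>M\<^esub>}"
    then have "\<ominus>\<^bsub>fun_mod M\<^esub> f = (\<ominus> \<one>) \<odot>\<^bsub>fun_mod M\<^esub> f" using W.smult_l_minus[of \<one> f] by simp
    then show "\<ominus>\<^bsub>fun_mod M\<^esub> f \<in> {f \<in> carrier (fun_mod M). f l = \<zero>\<^bsub>M\<^esub>}" using f by simp
  qed auto
qed

text \<open>Evaluation at \<open>l\<close> identifies \<open>fun_mod M\<close> modulo its kernel with \<open>M\<close>.\<close>

lemma exact_mod_eval_iff:
  assumes d: "free_chain R k d"
  shows "exact_mod R k d (fun_mod M) {f \<in> carrier (fun_mod M). f l = \<zero>\<^bsub>M\<^esub>} i \<longleftrightarrow>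
    exact_mod R k d M {\<zero>\<^bsub>M\<^esub>} i" (is "?L \<longleftrightarrow> ?R")
proof -
  interpret W: module R "fun_mod M" by (rule fun_mod_module)
  let ?F = "\<lambda>i. free_mod R (k i)" and ?H = "{f \<in> carrier (fun_mod M). f l = \<zero>\<^bsub>M\<^esub>}"
  have m: "module R (?F i)" for i by (rule free_mod_module) (rule R.is_cring)
  have dl: "d i \<in> lin_maps R (?F (Suc i)) (?F i)" for i using d by (simp add: free_chain_def)
  note dc [simp] = lin_mapsD(2)[OF dl]
  \<comment> \<open>Constant functions split the evaluation at \<open>l\<close>, so cochains can be
    moved in both directions.\<close>
  have const: "(\<lambda>x\<in>carrier (?F j). \<lambda>_. f x) \<in> lin_maps R (?F j) (fun_mod M)"
    if "f \<in> lin_maps R (?F j) M" for f j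
    by (rule module.lin_maps_comp[OF m that]) auto
  have eval: "(\<lambda>x\<in>carrier (?F j). f x l) \<in> lin_maps R (?F j) M"
    if "f \<in> lin_maps R (?F j) (fun_mod M)" for f j
    by (rule module.lin_maps_comp[OF m that]) auto
  have H: "a \<ominus>\<^bsub>fun_mod M\<^esub> b \<in> ?H \<longleftrightarrow> a l \<ominus>\<^bsub>M\<^esub> b l \<in> {\<zero>\<^bsub>M\<^esub>}"
    if "a \<in> carrier (fun_mod M)" "b \<in> carrier (fun_mod M)" for a b
    using W.minus_closed[OF that] fun_mod_minus[OF that] by simp
  show ?thesis
  proof
    assume L: ?L
    show ?R
      unfolding exact_mod_def
    proof (intro ballI impI)
      fix f assume f: "f \<in> lin_maps R (?F (Suc i)) M"
        and fd: "\<forall>x\<in>carrier (?F (Suc (Suc i))). f (d (Suc i) x) \<in> {\<zero>\<^bsub>M\<^esub>}"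
      obtain g where g: "g \<in> lin_maps R (?F i) (fun_mod M)"
        "\<forall>x\<in>carrier (?F (Suc i)). (\<lambda>x\<in>carrier (?F (Suc i)). \<lambda>_. f x) x \<ominus>\<^bsub>fun_mod M\<^esub> g (d i x) \<in> ?H"
        using L[unfolded exact_mod_def, rule_format, OF const[OF f]] fd by auto
      have "f x \<ominus>\<^bsub>M\<^esub> g (d i x) l \<in> {\<zero>\<^bsub>M\<^esub>}" if x: "x \<in> carrier (?F (Suc i))" for x
        using H[of "\<lambda>_. f x" "g (d i x)"] x g(2) lin_mapsD(2)[OF f] lin_mapsD(2)[OF g(1) dc[OF x]] by simp
      then show "\<exists>g\<in>lin_maps R (?F i) M. \<forall>x\<in>carrier (?F (Suc i)). f x \<ominus>\<^bsub>M\<^esub> g (d i x) \<in> {\<zero>\<^bsub>M\<^esub>}"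
        using eval[OF g(1)] by (intro bexI[OF _ eval[OF g(1)]]) simp
    qed
  next
    assume R: ?R
    show ?L
      unfolding exact_mod_def
    proof (intro ballI impI)
      fix f assume f: "f \<in> lin_maps R (?F (Suc i)) (fun_mod M)"
        and fd: "\<forall>x\<in>carrier (?F (Suc (Suc i))). f (d (Suc i) x) \<in> ?H"
      obtain g where g: "g \<in> lin_maps R (?F i) M"
        "\<forall>x\<in>carrier (?F (Suc i)). (\<lambda>x\<in>carrier (?F (Suc i)). f x l) x \<ominus>\<^bsub>M\<^esub> g (d i x) \<in> {\<zero>\<^bsub>M\<^esub>}"
        using R[unfolded exact_mod_def, rule_format, OF eval[OF f]] fd by auto
      have "f x \<ominus>\<^bsub>fun_mod M\<^esub> (\<lambda>_. g (d i x)) \<in> ?H" if x: "x \<in> carrier (?F (Suc i))" for x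
        using H[of "f x" "\<lambda>_. g (d i x)"] x g(2) lin_mapsD(2)[OF f x] lin_mapsD(2)[OF g(1) dc[OF x]] by simp
      then show "\<exists>g\<in>lin_maps R (?F i) (fun_mod M). \<forall>x\<in>carrier (?F (Suc i)).
          f x \<ominus>\<^bsub>fun_mod M\<^esub> g (d i x) \<in> ?H"
        by (intro bexI[OF _ const[OF g(1)]]) simp
    qed
  qed
qed

text \<open>Here \<open>C\<close> is the power of \<open>I\<close>: vanishing of Hom from R/I makes
  the successive quotients torsion-free for \<open>I\<close>, hence for its power, and that power
  acts null-homotopically on the resolution of R/J because it lies in \<open>J\<close>.\<close>

theorem exact_mod_res_power:
  assumes I: "ideal I R" and J: "ideal J R" and sub: "I [^]\<^bsub>ideals_set R\<^esub> (t::nat) \<subseteq> J"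
    and P: "free_resolution R (quot_mod (ring_mod R) I) P"
    and Q: "free_resolution R (quot_mod (ring_mod R) J) Q"
    and ex: "\<And>i. i < n \<Longrightarrow> exact_mod R (res_rk P) (res_bd R P) M {\<zero>\<^bsub>M\<^esub>} i" and i: "i < n"
  shows "exact_mod R (res_rk Q) (res_bd R Q) M {\<zero>\<^bsub>M\<^esub>} i"
proof -
  interpret W: self_power R "fun_mod M" "\<lambda>r f l. f (r # l)"
    "\<lambda>F l. case l of [] \<Rightarrow> \<zero>\<^bsub>M\<^esub> | r # l' \<Rightarrow> F r l'"
    by (rule fun_mod_self_power)
  note fP = free_chain_res[OF R.is_cring P] and fQ = free_chain_res[OF R.is_cring Q]
  \<comment> \<open>The quotient by this kernel is \<open>M\<close>, read off at the empty word; the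
    type annotation fixes words over the ring type.\<close>
  let ?H = "{f \<in> carrier (fun_mod M). f ([] :: 'a list) = \<zero>\<^bsub>M\<^esub>}"
  have "exact_mod R (res_rk Q) (res_bd R Q) (fun_mod M) ?H i"
  proof (rule W.exact_mod_transfer[OF fP fQ, where C = "I [^]\<^bsub>ideals_set R\<^esub> t"])
    show "I [^]\<^bsub>ideals_set R\<^esub> t \<subseteq> carrier R"
      using ideal.Icarr[OF R.ideal_pow_ideal[OF I]] by blast
    show "null_homotopic R (res_rk Q) (res_bd R Q) r" if "r \<in> I [^]\<^bsub>ideals_set R\<^esub> t" for r
      using res_null_homotopic[OF R.is_cring J Q] sub that by blast
    show "exact_mod R (res_rk P) (res_bd R P) (fun_mod M) ?H i" if "i < n" for i
      unfolding exact_mod_eval_iff[OF fP] by (rule ex[OF that])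
    show "x \<in> H"
      if "submodule H R (fun_mod M)" "exact_mod R (res_rk P) (res_bd R P) (fun_mod M) H 0"
        "x \<in> carrier (fun_mod M)"
        "\<And>r. r \<in> I [^]\<^bsub>ideals_set R\<^esub> t \<Longrightarrow> r \<odot>\<^bsub>fun_mod M\<^esub> x \<in> H" for H and x :: "'a list \<Rightarrow> 'c"
      by (rule W.pow_torsion_free[OF I W.exact_mod_0_torsion_free[OF I P that(1,2)] that(3,4)])
  qed (rule eval_kernel_submodule i)+
  then show ?thesis unfolding exact_mod_eval_iff[OF fQ] .
qed

end

section \<open>Ext and local cohomology below the depth\<close>

lemma hom_mod_simps [simp]:
  "carrier (hom_mod R M N) = lin_maps R M N"
  "\<zero>\<^bsub>hom_mod R M N\<^esub> = (\<lambda>x\<in>carrier M. \<zero>\<^bsub>N\<^esub>)"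
  "f \<oplus>\<^bsub>hom_mod R M N\<^esub> g = (\<lambda>x\<in>carrier M. f x \<oplus>\<^bsub>N\<^esub> g x)"
  "r \<odot>\<^bsub>hom_mod R M N\<^esub> f = (\<lambda>x\<in>carrier M. r \<odot>\<^bsub>N\<^esub> f x)"
  by (simp_all add: hom_mod_def)

lemma lin_maps_eqI:
  assumes "f \<in> lin_maps R M N" "g \<in> extensional (carrier M)" "\<And>x. x \<in> carrier M \<Longrightarrow> f x = g x"
  shows "f = g"
  using lin_mapsD(1)[OF assms(1)] assms(2,3) by (auto simp: PiE_iff intro: extensionalityI)

context module
begin

lemma minus_eq_zero_iff:
  assumes "x \<in> carrier M" "y \<in> carrier M" shows "x \<ominus>\<^bsub>M\<^esub> y = \<zero>\<^bsub>M\<^esub> \<longleftrightarrow> x = y"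
proof
  have "x = (x \<ominus>\<^bsub>M\<^esub> y) \<oplus>\<^bsub>M\<^esub> y"
    using assms by (simp add: a_minus_def M.a_assoc M.l_neg)
  then show "x \<ominus>\<^bsub>M\<^esub> y = \<zero>\<^bsub>M\<^esub> \<Longrightarrow> x = y" using assms by simp
qed (use assms in \<open>simp add: a_minus_def M.r_neg\<close>)

lemma hom_mod_module:
  assumes "module R K" shows "module R (hom_mod R K M)"
proof -
  interpret K: module R K by fact
  have zero: "(\<lambda>x\<in>carrier K. \<zero>\<^bsub>M\<^esub>) \<in> lin_maps R K M" by (auto simp: lin_maps_def)
  have smult: "(\<lambda>x\<in>carrier K. r \<odot>\<^bsub>M\<^esub> f x) \<in> lin_maps R K M"
    if "r \<in> carrier R" "f \<in> lin_maps R K M" for r f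
    by (rule K.lin_maps_comp[OF that(2)])
      (use that(1) in \<open>simp_all add: smult_r_distr smult_assoc1[symmetric] R.m_comm\<close>)
  have add: "(\<lambda>x\<in>carrier K. f x \<oplus>\<^bsub>M\<^esub> g x) \<in> lin_maps R K M"
    if "f \<in> lin_maps R K M" "g \<in> lin_maps R K M" for f g
    using lin_mapsD(2,3,4)[OF that(1)] lin_mapsD(2,3,4)[OF that(2)]
    by (auto simp: lin_maps_def[of _ _ M] smult_r_distr M.a_ac)
  show ?thesis
  proof (rule moduleI)
    show "abelian_group (hom_mod R K M)"
    proof (rule abelian_groupI)
      fix f assume "f \<in> carrier (hom_mod R K M)"
      then have f: "f \<in> lin_maps R K M" by simp
      then show "\<exists>g\<in>carrier (hom_mod R K M). g \<oplus>\<^bsub>hom_mod R K M\<^esub> f = \<zero>\<^bsub>hom_mod R K M\<^esub>"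
        using smult[of "\<ominus> \<one>" f] lin_mapsD(2)[OF f]
        by (intro bexI[of _ "\<lambda>x\<in>carrier K. (\<ominus> \<one>) \<odot>\<^bsub>M\<^esub> f x"])
          (auto simp: smult_l_minus M.l_neg intro!: restrict_ext)
      show "\<zero>\<^bsub>hom_mod R K M\<^esub> \<oplus>\<^bsub>hom_mod R K M\<^esub> f = f"
        by (rule lin_maps_eqI[OF f, symmetric]) (use lin_mapsD(2)[OF f] in auto)
    qed (auto simp: zero add lin_mapsD(2) M.a_ac intro!: restrict_ext)
  next
    fix f assume "f \<in> carrier (hom_mod R K M)"
    then have f: "f \<in> lin_maps R K M" by simp
    show "\<one> \<odot>\<^bsub>hom_mod R K M\<^esub> f = f"
      by (rule lin_maps_eqI[OF f, symmetric]) (use lin_mapsD(2)[OF f] in auto)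
  qed (auto simp: R.is_cring smult lin_mapsD(2) smult_l_distr smult_r_distr smult_assoc1
      intro!: restrict_ext)
qed

lemma compose_lin_maps:
  assumes "module R K" "module R L" and \<phi>: "\<phi> \<in> lin_maps R K L" and f: "f \<in> lin_maps R L M"
  shows "compose (carrier K) f \<phi> \<in> lin_maps R K M"
  unfolding compose_def
  by (rule module.lin_maps_comp[OF assms(1) \<phi>]) (simp_all add: lin_mapsD[OF f])

text \<open>With precomposition as a linear map, cocycles become a kernel and coboundaries an image,
  hence submodules.\<close>

lemma pullback_lin_maps:
  assumes "module R K" "module R L" and \<phi>: "\<phi> \<in> lin_maps R K L"
  shows "(\<lambda>f\<in>carrier (hom_mod R L M). compose (carrier K) f \<phi>)
    \<in> lin_maps R (hom_mod R L M) (hom_mod R K M)"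
proof -
  interpret HL: module R "hom_mod R L M" by (rule hom_mod_module) fact
  show ?thesis
    unfolding lin_maps_def[of R "hom_mod R L M"]
    using HL.M.a_closed HL.smult_closed compose_lin_maps[OF assms] lin_mapsD(2)[OF \<phi>]
    by (auto simp: compose_def intro!: restrict_ext)
qed

lemma submodule_in_submodule:
  assumes N: "submodule N R M" and H: "submodule H R M" and "H \<subseteq> N"
  shows "submodule H R (M\<lparr>carrier := N\<rparr>)"
proof -
  interpret N: module R "M\<lparr>carrier := N\<rparr>" by (rule submodule.submodule_is_module[OF N module_axioms])
  show ?thesis
    by (rule N.module_incl_imp_submodule)
      (use \<open>H \<subseteq> N\<close> submodule.submodule_is_module[OF H module_axioms] in simp_all)
qed

lemma quot_mod_trivial_iff:
  assumes N: "submodule N R M"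
  shows "carrier (quot_mod M N) = {\<zero>\<^bsub>quot_mod M N\<^esub>} \<longleftrightarrow> carrier M \<subseteq> N"
proof -
  interpret S: abelian_subgroup N M
    using N M.abelian_group_axioms
    by (auto intro!: abelian_subgroupI3 additive_subgroup.intro dest: submodule.axioms(1))
  have car: "carrier (quot_mod M N) = (\<lambda>x. N +>\<^bsub>M\<^esub> x) ` carrier M"
    and zero: "\<zero>\<^bsub>quot_mod M N\<^esub> = N"
    by (auto simp: quot_mod_def A_RCOSETS_def')
  have iff: "N +>\<^bsub>M\<^esub> x = N \<longleftrightarrow> x \<in> N" if "x \<in> carrier M" for x
    using that S.a_rcos_const S.a_rcos_self by metis
  have ne: "(\<lambda>x. N +>\<^bsub>M\<^esub> x) ` carrier M \<noteq> {}" using M.zero_closed by blast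
  have "(\<lambda>x. N +>\<^bsub>M\<^esub> x) ` carrier M = {N} \<longleftrightarrow> (\<lambda>x. N +>\<^bsub>M\<^esub> x) ` carrier M \<subseteq> {N}"
    using ne by (metis subset_singletonD subset_refl)
  also have "\<dots> \<longleftrightarrow> carrier M \<subseteq> N" by (simp add: image_subset_iff iff subset_eq)
  finally show ?thesis unfolding car zero .
qed

text \<open>Used to evaluate \<open>Ext_map\<close> at zero, where a set of coboundaries is added to
  the submodule of all coboundaries.\<close>

lemma submodule_set_add:
  assumes H: "submodule H R M" and "S \<subseteq> H" "S \<noteq> {}"
  shows "H <+>\<^bsub>M\<^esub> S = H"
proof
  note HE = submoduleE[OF H]
  show "H <+>\<^bsub>M\<^esub> S \<subseteq> H" using HE(5) assms(2) by (auto simp: set_add_def')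
  obtain s where s: "s \<in> S" using assms(3) by blast
  show "H \<subseteq> H <+>\<^bsub>M\<^esub> S"
  proof
    fix h assume h: "h \<in> H"
    have "h = (h \<ominus>\<^bsub>M\<^esub> s) \<oplus>\<^bsub>M\<^esub> s"
      using h s assms(2) HE(1) by (simp add: a_minus_def M.a_assoc M.l_neg subset_iff)
    moreover have "h \<ominus>\<^bsub>M\<^esub> s \<in> H" using minus_in_submodule[OF H h] s assms(2) by blast
    ultimately show "h \<in> H <+>\<^bsub>M\<^esub> S" using s by (auto simp: set_add_def')
  qed
qed

lemma cochains_module: "module R (cochains R F M i)"
  unfolding cochains_def by (rule hom_mod_module) (rule free_mod_module[OF R.is_cring])

section \<open>Cohomology of a resolution with coefficients in a module\<close>

context
  fixes N :: "('a, 'n, 'y) module_scheme" and F :: "('a, 'n) free_complex"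
  assumes F: "free_resolution R N F"
begin

lemma res_bd_lin_maps: "bd F i \<in> lin_maps R (free_mod R (rk F (Suc i))) (free_mod R (rk F i))"
  using F by (simp add: free_resolution_def)

lemma coboundary_lin_maps:
  "(\<lambda>f\<in>carrier (cochains R F M i). compose (carrier (free_mod R (rk F (Suc i)))) f (bd F i))
    \<in> lin_maps R (cochains R F M i) (cochains R F M (Suc i))"
  unfolding cochains_def
  by (intro pullback_lin_maps free_mod_module R.is_cring res_bd_lin_maps)

lemma cocycles_submodule: "submodule (cocycles R F M i) R (cochains R F M i)"
proof -
  have "cocycles R F M i = {f \<in> carrier (cochains R F M i).
     (\<lambda>f\<in>carrier (cochains R F M i). compose (carrier (free_mod R (rk F (Suc i)))) f (bd F i)) f
       = \<zero>\<^bsub>cochains R F M (Suc i)\<^esub>}"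
    unfolding cocycles_def by auto
  then show ?thesis
    by (simp only: module.kernel_submodule[OF cochains_module cochains_module coboundary_lin_maps])
qed

lemma coboundaries_submodule: "submodule (coboundaries R F M i) R (cochains R F M i)"
proof (cases i)
  case 0
  interpret C: module R "cochains R F M 0" by (rule cochains_module)
  show ?thesis
    unfolding 0 using C.smult_r_minus[of "\<zero>" "\<zero>\<^bsub>cochains R F M 0\<^esub>"]
    by (intro C.submoduleI) auto
next
  case (Suc j)
  interpret C: module R "cochains R F M j" by (rule cochains_module)
  show ?thesis
    using C.image_submodule[OF cochains_module coboundary_lin_maps C.carrier_is_submodule]
    unfolding Suc by simp
qed

lemma coboundaries_cocycles: "coboundaries R F M i \<subseteq> cocycles R F M i"
proof
  fix f assume f: "f \<in> coboundaries R F M i"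
  note Z = cocycles_submodule[of i]
  show "f \<in> cocycles R F M i"
  proof (cases i)
    case 0
    then show ?thesis using f module.submodule_zero[OF cochains_module Z] by simp
  next
    case (Suc j)
    then obtain g where g: "g \<in> carrier (cochains R F M j)"
      "f = compose (carrier (free_mod R (rk F (Suc j)))) g (bd F j)"
      using f by auto
    have gl: "g \<in> lin_maps R (free_mod R (rk F j)) M" using g(1) by (simp add: cochains_def)
    have m: "module R (free_mod R k)" for k by (rule free_mod_module[OF R.is_cring])
    have "f \<in> carrier (cochains R F M i)"
      using f submodule.axioms(1)[OF coboundaries_submodule] subgroup.subset by fastforce
    moreover have "compose (carrier (free_mod R (rk F (Suc i)))) f (bd F i) = \<zero>\<^bsub>cochains R F M (Suc i)\<^esub>"
      using free_resolution_bd_bd[OF F] lin_mapsD(2)[OF res_bd_lin_maps[of "Suc j"]]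
        module.lin_maps_zero[OF m module_axioms gl]
      unfolding cochains_def hom_mod_simps g(2) Suc compose_def
      by (auto intro!: restrict_ext)
    ultimately show ?thesis by (simp add: cocycles_def)
  qed
qed

text \<open>The zero module at the start of the shifted complex merges the two clauses of
  \<open>coboundaries\<close>: in degree 0 every \<open>g\<close> is evaluated at zero.\<close>

lemma coboundaries_iff:
  assumes f: "f \<in> carrier (cochains R F M i)"
  shows "f \<in> coboundaries R F M i \<longleftrightarrow> (\<exists>g\<in>lin_maps R (free_mod R (res_rk F i)) M.
    \<forall>x\<in>carrier (free_mod R (rk F i)). f x = g (res_bd R F i x))"
proof (cases i)
  case 0
  interpret F0: module R "free_mod R 0" by (rule free_mod_module[OF R.is_cring])
  have fl: "f \<in> lin_maps R (free_mod R (rk F 0)) M" using f 0 by (simp add: cochains_def)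
  have z: "(\<lambda>x\<in>carrier (free_mod R 0). \<zero>\<^bsub>M\<^esub>) \<in> lin_maps R (free_mod R 0) M"
    by (auto simp: lin_maps_def)
  have "f \<in> coboundaries R F M 0 \<longleftrightarrow> (\<forall>x\<in>carrier (free_mod R (rk F 0)). f x = \<zero>\<^bsub>M\<^esub>)"
    using lin_maps_eqI[OF fl, of "\<lambda>x\<in>carrier (free_mod R (rk F 0)). \<zero>\<^bsub>M\<^esub>"]
    by (auto simp: cochains_def)
  moreover have "g (res_bd R F 0 x) = \<zero>\<^bsub>M\<^esub>"
    if "g \<in> lin_maps R (free_mod R 0) M" "x \<in> carrier (free_mod R (rk F 0))" for g x
    using F0.lin_maps_zero[OF module_axioms that(1)] that(2) by simp
  ultimately show ?thesis unfolding 0 using z by (metis res_simps(1))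
next
  case (Suc j)
  have fl: "f \<in> lin_maps R (free_mod R (rk F (Suc j))) M" using f Suc by (simp add: cochains_def)
  have "f = compose (carrier (free_mod R (rk F (Suc j)))) g (bd F j) \<longleftrightarrow>
      (\<forall>x\<in>carrier (free_mod R (rk F (Suc j))). f x = g (bd F j x))" for g
    using lin_maps_eqI[OF fl, of "compose (carrier (free_mod R (rk F (Suc j)))) g (bd F j)"]
    by (auto simp: compose_def)
  then show ?thesis unfolding Suc by (auto simp: cochains_def)
qed

lemma cocycles_iff:
  "f \<in> cocycles R F M i \<longleftrightarrow> f \<in> lin_maps R (free_mod R (rk F i)) M \<and>
    (\<forall>x\<in>carrier (free_mod R (rk F (Suc i))). f (bd F i x) = \<zero>\<^bsub>M\<^esub>)"
proof -
  have "restrict u A = restrict v A \<longleftrightarrow> (\<forall>x\<in>A. u x = v x)"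
    for A :: "(nat \<Rightarrow> 'a) set" and u v :: "(nat \<Rightarrow> 'a) \<Rightarrow> 'c"
    by (metis restrict_apply' restrict_ext)
  then show ?thesis unfolding cocycles_def cochains_def compose_def hom_mod_simps by simp
qed

text \<open>With zero submodule, congruence is equality, and \<open>exact_mod\<close> says that each
  cocycle is a coboundary. This carries vanishing of Ext into the setting of dimension shifting and
  back.\<close>

lemma cohomology_trivial_iff:
  fixes i :: nat
  defines "E \<equiv> quot_mod ((cochains R F M i)\<lparr>carrier := cocycles R F M i\<rparr>) (coboundaries R F M i)"
  shows "module R E"
    and "carrier E = {\<zero>\<^bsub>E\<^esub>} \<longleftrightarrow> exact_mod R (res_rk F) (res_bd R F) M {\<zero>\<^bsub>M\<^esub>} i"
proof -
  let ?Z = "(cochains R F M i)\<lparr>carrier := cocycles R F M i\<rparr>"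
  interpret Z: module R ?Z
    by (rule submodule.submodule_is_module[OF cocycles_submodule cochains_module])
  have B: "submodule (coboundaries R F M i) R ?Z"
    by (rule module.submodule_in_submodule[OF cochains_module cocycles_submodule
          coboundaries_submodule coboundaries_cocycles])
  show "module R E" unfolding E_def by (rule Z.quot_mod_module[OF B])
  have eq: "(f x \<ominus>\<^bsub>M\<^esub> g (res_bd R F i x) \<in> {\<zero>\<^bsub>M\<^esub>}) = (f x = g (res_bd R F i x))"
    if "f \<in> lin_maps R (free_mod R (rk F i)) M" "g \<in> lin_maps R (free_mod R (res_rk F i)) M"
      "x \<in> carrier (free_mod R (rk F i))" for f g x
  proof -
    have "res_bd R F i x \<in> carrier (free_mod R (res_rk F i))"
      using free_chain_res[OF R.is_cring F] lin_mapsD(2) that(3) unfolding free_chain_def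
      by (metis res_simps(2))
    then show ?thesis
      using lin_mapsD(2)[OF that(1,3)] lin_mapsD(2)[OF that(2)] by (simp add: minus_eq_zero_iff)
  qed
  have "carrier E = {\<zero>\<^bsub>E\<^esub>} \<longleftrightarrow> cocycles R F M i \<subseteq> coboundaries R F M i"
    unfolding E_def using Z.quot_mod_trivial_iff[OF B] by simp
  also have "\<dots> \<longleftrightarrow> (\<forall>f\<in>cocycles R F M i. \<exists>g\<in>lin_maps R (free_mod R (res_rk F i)) M.
      \<forall>x\<in>carrier (free_mod R (rk F i)). f x = g (res_bd R F i x))"
    unfolding subset_eq by (intro ball_cong refl coboundaries_iff) (simp add: cocycles_def)
  also have "\<dots> \<longleftrightarrow> (\<forall>f\<in>cocycles R F M i. \<exists>g\<in>lin_maps R (free_mod R (res_rk F i)) M.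
      \<forall>x\<in>carrier (free_mod R (rk F i)). f x \<ominus>\<^bsub>M\<^esub> g (res_bd R F i x) \<in> {\<zero>\<^bsub>M\<^esub>})"
    by (intro ball_cong bex_cong refl eq[symmetric]) (simp_all add: cocycles_iff)
  also have "\<dots> \<longleftrightarrow> exact_mod R (res_rk F) (res_bd R F) M {\<zero>\<^bsub>M\<^esub>} i"
    unfolding exact_mod_def
    by (simp only: res_simps(2,3) cocycles_iff singleton_iff Ball_def imp_conjL)
  finally show "carrier E = {\<zero>\<^bsub>E\<^esub>} \<longleftrightarrow> exact_mod R (res_rk F) (res_bd R F) M {\<zero>\<^bsub>M\<^esub>} i" .
qed

end

end

section \<open>Pullback along chain maps\<close>

lemma (in module) pullback_coboundaries:
  assumes F: "free_resolution R N F" and F': "free_resolution R N' F'"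
    and \<phi>: "chain_lift R F F' h \<phi>"
  shows "(\<lambda>f. compose (carrier (free_mod R (rk F i))) f (\<phi> i)) ` coboundaries R F' M i
    \<subseteq> coboundaries R F M i"
proof
  have m: "module R (free_mod R k)" for k by (rule free_mod_module[OF R.is_cring])
  have \<phi>l: "\<phi> j \<in> lin_maps R (free_mod R (rk F j)) (free_mod R (rk F' j))" for j
    using \<phi> by (simp add: chain_lift_def)
  fix f assume "f \<in> (\<lambda>f. compose (carrier (free_mod R (rk F i))) f (\<phi> i)) ` coboundaries R F' M i"
  then obtain f' where f': "f' \<in> coboundaries R F' M i"
    "f = compose (carrier (free_mod R (rk F i))) f' (\<phi> i)" by blast
  show "f \<in> coboundaries R F M i"
  proof (cases i)
    case 0
    then have "f = \<zero>\<^bsub>cochains R F M 0\<^esub>"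
      using f' lin_mapsD(2)[OF \<phi>l[of 0]]
      by (auto simp: cochains_def compose_def intro!: restrict_ext)
    then show ?thesis using 0 by simp
  next
    case (Suc j)
    then obtain g where g: "g \<in> lin_maps R (free_mod R (rk F' j)) M"
      "f' = compose (carrier (free_mod R (rk F' (Suc j)))) g (bd F' j)"
      using f'(1) by (auto simp: cochains_def)
    \<comment> \<open>As the chain map commutes with the boundaries, the pullback is the coboundary
      of \<open>g\<close> composed with \<open>\<phi> j\<close>.\<close>
    have "f = compose (carrier (free_mod R (rk F (Suc j))))
        (compose (carrier (free_mod R (rk F j))) g (\<phi> j)) (bd F j)"
      using \<phi> lin_mapsD(2)[OF \<phi>l[of "Suc j"]] lin_mapsD(2)[OF res_bd_lin_maps[OF F, of j]]
      unfolding f'(2) g(2) Suc compose_def chain_lift_def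
      by (auto intro!: restrict_ext)
    then show ?thesis
      using compose_lin_maps[OF m m \<phi>l g(1)] unfolding Suc by (simp add: cochains_def)
  qed
qed

section \<open>Trivial direct limits, supports and dimensions\<close>

lemma chain_dim_empty: "chain_dim ({} :: 'r set set) = -\<infinity>"
proof -
  have "{ereal (real k) | k. \<exists>P :: nat \<Rightarrow> 'r set. (\<forall>i\<le>k. P i \<in> ({} :: 'r set set)) \<and> (\<forall>i<k. P i \<subset> P (Suc i))} = {}"
    by blast
  then show ?thesis unfolding chain_dim_def by (simp only: Sup_empty bot_ereal_def)
qed

text \<open>All pairs of an index and its zero are identified, so the limit has the single class
  \<open>Z\<close>. The module laws are checked directly on it.\<close>

lemma dirlim_trivial:
  assumes R: "cring R" and G: "\<And>t. module R (G t)" "\<And>t. carrier (G t) = {\<zero>\<^bsub>G t\<^esub>}"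
    and \<theta>: "\<And>s t. s \<le> t \<Longrightarrow> \<theta> s t \<zero>\<^bsub>G s\<^esub> = \<zero>\<^bsub>G t\<^esub>"
  shows "module R (dirlim G \<theta>)" and "carrier (dirlim G \<theta>) = {\<zero>\<^bsub>dirlim G \<theta>\<^esub>}"
proof -
  let ?L = "dirlim G \<theta>"
  define Z where "Z = range (\<lambda>t. (t, \<zero>\<^bsub>G t\<^esub>))"
  have cls: "dirlim_class G \<theta> (s, \<zero>\<^bsub>G s\<^esub>) = Z" for s
  proof -
    have "\<exists>u. s \<le> u \<and> t \<le> u \<and> \<theta> s u \<zero>\<^bsub>G s\<^esub> = \<theta> t u \<zero>\<^bsub>G t\<^esub>" for t
      using \<theta> by (intro exI[of _ "max s t"]) simp
    then show ?thesis by (auto simp: dirlim_class_def Z_def G(2))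
  qed
  have zero: "\<zero>\<^bsub>?L\<^esub> = Z" by (simp add: dirlim_def cls)
  have car: "carrier ?L = {Z}" by (auto simp: dirlim_def G(2) cls image_iff)
  have "\<zero>\<^bsub>G t\<^esub> \<oplus>\<^bsub>G t\<^esub> \<zero>\<^bsub>G t\<^esub> = \<zero>\<^bsub>G t\<^esub>" for t
    using abelian_monoid.l_zero[OF abelian_group.axioms(1)[OF module.axioms(2)[OF G(1)]]] G(2) by blast
  then have "dirlim_class G \<theta> (max s t, \<theta> s (max s t) \<zero>\<^bsub>G s\<^esub> \<oplus>\<^bsub>G (max s t)\<^esub> \<theta> t (max s t) \<zero>\<^bsub>G t\<^esub>) = Z"
    for s t using \<theta> cls by simp
  then have add: "Z \<oplus>\<^bsub>?L\<^esub> Z = Z" unfolding dirlim_def by (auto simp: Z_def)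
  have smult: "r \<odot>\<^bsub>?L\<^esub> Z = Z" if "r \<in> carrier R" for r
    unfolding dirlim_def using module.smult_r_null[OF G(1) that] cls by (auto simp: Z_def)
  show "module R ?L"
  proof (rule moduleI[OF R])
    show "abelian_group ?L"
      by (rule abelian_groupI) (auto simp: car zero add)
  qed (use R in \<open>auto simp: car smult add cring.cring_simprules\<close>)
  show "carrier ?L = {\<zero>\<^bsub>?L\<^esub>}" using car zero by simp
qed

context module
begin

lemma Supp_trivial:
  assumes M: "carrier M = {\<zero>\<^bsub>M\<^esub>}" shows "Supp R M = {}"
proof -
  have "localisation R M \<pp> = {fraction_rel R M \<pp> `` {(\<zero>\<^bsub>M\<^esub>, \<one>)}}" if "primeideal \<pp> R" for \<pp>
  proof -
    interpret primeideal \<pp> R by fact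
    have one: "\<one> \<in> carrier R - \<pp>" using one_imp_carrier I_notcarr by auto
    have "fraction_rel R M \<pp> `` {(\<zero>\<^bsub>M\<^esub>, s)} = {\<zero>\<^bsub>M\<^esub>} \<times> (carrier R - \<pp>)"
      if "s \<in> carrier R - \<pp>" for s
      using one that unfolding fraction_rel_def M by auto
    then show ?thesis
      unfolding localisation_def quotient_def M using one by auto
  qed
  then show ?thesis by (auto simp: Supp_def)
qed

text \<open>The whole module serves as the finitely generated submodule, generated by the empty set.
  The quotient has empty support, of dimension -\<infinity>, which is below \<open>n\<close> even
  for \<open>n = 0\<close>.\<close>

lemma in_dim_less_trivial:
  assumes M: "carrier M = {\<zero>\<^bsub>M\<^esub>}" shows "in_dim_less R n M"
proof -
  let ?Q = "quot_mod M (carrier M)"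
  note S = carrier_is_submodule
  interpret Q: module R ?Q by (rule quot_mod_module[OF S])
  have "Supp R ?Q = {}" using quot_mod_trivial_iff[OF S] by (intro Q.Supp_trivial) simp
  then have "chain_dim (Supp R ?Q) < ereal (real n)" by (simp add: chain_dim_empty)
  moreover have "submod_gen R M {} = carrier M"
    using submod_gen_submodule[of "{}"] submodule_zero submoduleE(1) M by (intro equalityI) auto
  then have "finitely_generated R M" unfolding finitely_generated_def by blast
  ultimately show ?thesis unfolding in_dim_less_def using S by (intro exI[of _ "carrier M"]) simp
qed

lemma ideal_smult_trivial:
  assumes M: "carrier M = {\<zero>\<^bsub>M\<^esub>}" and I: "I \<subseteq> carrier R"
  shows "ideal_smult R I M = carrier M"
proof -
  let ?S = "{r \<odot>\<^bsub>M\<^esub> x | r x. r \<in> I \<and> x \<in> carrier M}"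
  have "submodule (submod_gen R M ?S) R M"
    using I by (intro submod_gen_submodule) auto
  from submoduleE(1)[OF this] submodule_zero[OF this] show ?thesis
    unfolding ideal_smult_def M by (intro equalityI) simp_all
qed

section \<open>Vanishing of Ext and of local cohomology\<close>

lemma Ext_module:
  assumes "noetherian_ring R" "ideal I R"
  shows "module R (Ext R i (quot_mod (ring_mod R) I) M)"
  using cohomology_trivial_iff(1)[OF resolution_quot_ring[OF R.is_cring assms]]
  by (simp add: Ext_def Let_def)

lemma Ext_trivial_iff:
  fixes i :: nat
  assumes "noetherian_ring R" "ideal I R"
  defines "F \<equiv> resolution R (quot_mod (ring_mod R) I)" and "E \<equiv> Ext R i (quot_mod (ring_mod R) I) M"
  shows "carrier E = {\<zero>\<^bsub>E\<^esub>} \<longleftrightarrow> exact_mod R (res_rk F) (res_bd R F) M {\<zero>\<^bsub>M\<^esub>} i"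
  using cohomology_trivial_iff(2)[OF resolution_quot_ring[OF R.is_cring assms(1,2)]]
  unfolding E_def F_def Ext_def Let_def .

lemma Ext_trivial_below_depth:
  assumes "enat i < depth R I M"
  shows "carrier (Ext R i (quot_mod (ring_mod R) I) M) = {\<zero>\<^bsub>Ext R i (quot_mod (ring_mod R) I) M\<^esub>}"
proof (rule ccontr)
  assume "\<not> ?thesis"
  then have "depth R I M \<le> enat i" unfolding depth_def Let_def by (intro Inf_lower) blast
  then show False using assms by simp
qed

text \<open>The zero class is the set of coboundaries, and chain maps pull coboundaries back to
  coboundaries. This is what makes the transition maps of the direct system preserve zero.\<close>

lemma Ext_map_zero:
  assumes "noetherian_ring R" "ideal I R" "ideal J R" "I \<subseteq> J"
  shows "Ext_map R i (quot_mod (ring_mod R) I) (quot_mod (ring_mod R) J) (\<lambda>X. J <+>\<^bsub>R\<^esub> X) M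
      \<zero>\<^bsub>Ext R i (quot_mod (ring_mod R) J) M\<^esub> = \<zero>\<^bsub>Ext R i (quot_mod (ring_mod R) I) M\<^esub>"
proof -
  define F F' where "F = resolution R (quot_mod (ring_mod R) I)"
    and "F' = resolution R (quot_mod (ring_mod R) J)"
  have F: "free_resolution R (quot_mod (ring_mod R) I) F"
    and F': "free_resolution R (quot_mod (ring_mod R) J) F'"
    unfolding F_def F'_def by (rule resolution_quot_ring[OF R.is_cring]; fact assms)+
  define \<phi> where "\<phi> = (SOME \<phi>. chain_lift R F F' (\<lambda>X. J <+>\<^bsub>R\<^esub> X) \<phi>)"
  have "chain_lift R F F' (\<lambda>X. J <+>\<^bsub>R\<^esub> X) \<phi>"
    using someI_ex[OF lift_quot_ring_exists[OF R.is_cring assms]] unfolding \<phi>_def F_def F'_def .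
  note sub = pullback_coboundaries[OF F F' this, of i]
  have "coboundaries R F' M i \<noteq> {}"
    using module.submoduleE(2)[OF cochains_module coboundaries_submodule[OF F']] .
  then have "coboundaries R F M i <+>\<^bsub>cochains R F M i\<^esub>
      (\<lambda>f. compose (carrier (free_mod R (rk F i))) f (\<phi> i)) ` coboundaries R F' M i = coboundaries R F M i"
    using module.submodule_set_add[OF cochains_module coboundaries_submodule[OF F] sub] by simp
  moreover have "\<zero>\<^bsub>quot_mod L K\<^esub> = K" for L :: "('a, (nat \<Rightarrow> 'a) \<Rightarrow> 'c) module" and K
    by (simp add: quot_mod_def)
  ultimately show ?thesis
    unfolding Ext_map_def Ext_def Let_def F_def[symmetric] F'_def[symmetric] \<phi>_def[symmetric]
    by simp
qed

theorem local_cohomology_trivial_below_depth: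
  assumes R: "noetherian_ring R" and \<aa>: "ideal \<aa> R" and \<bb>: "ideal \<bb> R" and "\<bb> \<subseteq> \<aa>"
    and i: "enat i < depth R \<bb> M"
  shows "module R (local_cohomology R \<aa> i M)"
    and "carrier (local_cohomology R \<aa> i M) = {\<zero>\<^bsub>local_cohomology R \<aa> i M\<^esub>}"
proof -
  let ?E = "\<lambda>t. Ext R i (quot_pow R \<aa> t) M"
  note pow = R.ideal_pow_ideal[OF \<aa>]
  have mod: "module R (?E t)" for t unfolding quot_pow_def by (rule Ext_module[OF R pow])
  have triv: "carrier (?E t) = {\<zero>\<^bsub>?E t\<^esub>}" for t
    unfolding quot_pow_def Ext_trivial_iff[OF R pow]
  \<comment> \<open>The power of \<open>\<bb>\<close> lies in the same power of
    \<open>\<aa>\<close>, and the bound is \<open>Suc i\<close> so that degree \<open>i\<close> is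
    included.\<close>
  proof (rule exact_mod_res_power[OF \<bb> pow R.ideal_pow_mono[OF \<open>\<bb> \<subseteq> \<aa>\<close>]])
    show "exact_mod R (res_rk (resolution R (quot_mod (ring_mod R) \<bb>)))
        (res_bd R (resolution R (quot_mod (ring_mod R) \<bb>))) M {\<zero>\<^bsub>M\<^esub>} j" if "j < Suc i" for j
    proof -
      have "enat j < depth R \<bb> M" using that i by (cases "depth R \<bb> M") auto
      then show ?thesis using Ext_trivial_below_depth Ext_trivial_iff[OF R \<bb>, of j] by simp
    qed
  qed (use resolution_quot_ring[OF R.is_cring R] \<bb> pow in auto)
  have zero: "Ext_map R i (quot_pow R \<aa> t) (quot_pow R \<aa> s)
      (\<lambda>X. (\<aa> [^]\<^bsub>ideals_set R\<^esub> s) <+>\<^bsub>R\<^esub> X) M \<zero>\<^bsub>?E s\<^esub> = \<zero>\<^bsub>?E t\<^esub>" if "s \<le> t" for s t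
    unfolding quot_pow_def by (rule Ext_map_zero[OF R pow pow R.ideal_pow_antimono[OF \<aa> that]])
  show "module R (local_cohomology R \<aa> i M)"
    unfolding local_cohomology_def by (rule dirlim_trivial(1)[OF R.is_cring]) (fact mod triv zero)+
  show "carrier (local_cohomology R \<aa> i M) = {\<zero>\<^bsub>local_cohomology R \<aa> i M\<^esub>}"
    unfolding local_cohomology_def by (rule dirlim_trivial(2)[OF R.is_cring]) (fact mod triv zero)+
qed

end

section \<open>Both invariants bounded below by the depth\<close>

theorem theorem3p2:
  fixes R :: "('r, 'q) ring_scheme" and M :: "('r, 'm, 'x) module_scheme"
    and \<aa> \<bb> :: "'r set" and n :: nat
  assumes "cring R" and "noetherian_ring R" and "\<one>\<^bsub>R\<^esub> \<noteq> \<zero>\<^bsub>R\<^esub>"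
    and "module R M" and "finitely_generated R M"
    and "ideal \<aa> R" and "ideal \<bb> R" and "\<bb> \<subseteq> \<aa>"
  shows "h_dim_rel R \<aa> \<bb> n M \<ge> depth R \<bb> M \<longleftrightarrow> h_dim R \<aa> n M \<ge> depth R \<bb> M"
proof -
  interpret module R M by fact
  note triv = local_cohomology_trivial_below_depth[OF assms(2,6,7,8)]
  have dim: "in_dim_less R n (local_cohomology R \<aa> i M)" if "enat i < depth R \<bb> M" for i
    by (rule module.in_dim_less_trivial[OF triv[OF that]])
  \<comment> \<open>The exponent 1 is enough to refute the condition for all positive exponents, as
    the product submodule of a zero module is the module itself.\<close>
  have dim': "in_dim_less R n (local_cohomology R \<aa> i M
      \<lparr>carrier := ideal_smult R (\<bb> [^]\<^bsub>ideals_set R\<^esub> (1::nat)) (local_cohomology R \<aa> i M)\<rparr>)"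
    if i: "enat i < depth R \<bb> M" for i
  proof -
    have "\<bb> [^]\<^bsub>ideals_set R\<^esub> (1::nat) \<subseteq> carrier R"
      using ideal.Icarr[OF R.ideal_pow_ideal[OF assms(7)]] by blast
    from module.ideal_smult_trivial[OF triv[OF i] this] show ?thesis
      using dim[OF i] by (simp del: nat_pow_Suc One_nat_def)
  qed
  have "depth R \<bb> M \<le> h_dim_rel R \<aa> \<bb> n M"
    unfolding h_dim_rel_def
  proof (rule Inf_greatest)
    fix x assume "x \<in> {enat i | i. \<forall>t\<ge>1. let H = local_cohomology R \<aa> i M in
      \<not> in_dim_less R n (H\<lparr>carrier := ideal_smult R (\<bb> [^]\<^bsub>ideals_set R\<^esub> (t::nat)) H\<rparr>)}"
    then obtain i where i: "x = enat i" "\<forall>t\<ge>1. \<not> in_dim_less R n (local_cohomology R \<aa> i M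
        \<lparr>carrier := ideal_smult R (\<bb> [^]\<^bsub>ideals_set R\<^esub> (t::nat)) (local_cohomology R \<aa> i M)\<rparr>)"
      unfolding Let_def by blast
    from i(2) have "\<not> enat i < depth R \<bb> M" using dim'[of i] le_refl[of "1::nat"] by blast
    then show "depth R \<bb> M \<le> x" using i(1) by simp
  qed
  moreover have "depth R \<bb> M \<le> h_dim R \<aa> n M"
    unfolding h_dim_def
  proof (rule Inf_greatest)
    fix x assume "x \<in> {enat i | i. \<not> in_dim_less R n (local_cohomology R \<aa> i M)}"
    then obtain i where "x = enat i" "\<not> enat i < depth R \<bb> M" using dim by blast
    then show "depth R \<bb> M \<le> x" by simp
  qed
  ultimately show ?thesis by simp
qed

end
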